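(* Let $R$ be a domain of characteristic $p\ge 0$ which is not a field, and let $K$ be its field of fractions. Let $\mathcal{H}_1,\mathcal{H}_2$ be two affine type subgroups of $\mathrm{Aut}_K K[x_1,x_2]$ such that $\mathcal{H}_1\subsetneq\mathcal{H}_2$. Then $T(\mathcal{H}_1)$ is a subgroup of $T(\mathcal{H}_2)$ which is not normal.
   Context: $\mathrm{Aut}_K K[x_1,x_2]$ is the group (under composition) of $K$-algebra automorphisms of $K[x_1,x_2]$, and $\mathrm{Aut}_R R[x_1,x_2]$ is regarded as a subgroup of it in the natural way. An automorphism $\phi$ is identified with $(\phi(x),\phi(y))$, where $x=x_1$, $y=x_2$. $\langle\cdot\rangle$ denotes generated subgroup. Let $\mathcal{A}=\mathrm{Aff}_2(K)$ be the group of affine automorphisms, i.e. those with $(\phi(x_1),\phi(x_2))=(x_1,x_2)M+(b_1,b_2)$, $M\in\mathrm{GL}_2(K)$, $b_i\in K$. For $I\subset\mathbb{N}_{\ge 2}$ (integers $\ge 2$) put $\mathcal{B}^I=\{(x+P(y),y) : P(y)\in\bigoplus_{i\in I}Ky^i\}$ and $\mathcal{A}^I=\langle\mathcal{A},\mathcal{B}^I\rangle$. The set $I$ is called $p$-stable if for every $n\in I$ and every integer $k$ with $2\le k\le n$, either $\binom{n}{k}\equiv 0 \bmod p$ or $k\in I$ (when $p=0$, "$\equiv 0\bmod p$" means "$=0$"). A subgroup $\mathcal{H}$ of $\mathrm{Aut}_K K[x_1,x_2]$ is an affine type subgroup if $\mathcal{H}=\mathcal{A}^I$ for some $p$-stable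 $I\subset\mathbb{N}_{\ge2}$. The tame subgroup $\mathrm{T}_2(R)\subset\mathrm{Aut}_R R[x_1,x_2]$ is generated by the affine automorphisms over $R$ (matrix in $\mathrm{GL}_2(R)$, translation part in $R^2$) and the elementary automorphisms (those fixing one variable $x_m$ and sending the other variable $x_l$ to $ax_l+f$ with $a\in R^\times$, $f\in R[x_m]$). For an affine type subgroup $\mathcal{H}$, $T(\mathcal{H})=\langle\mathcal{H}\cap\mathrm{Aut}_R R[x_1,x_2],\ \mathrm{T}_2(R)\rangle$. *)

theory Defs
  imports
    "HOL-Analysis.Cartesian_Space"
    "HOL-Computational_Algebra.Computational_Algebra"
    "HOL-Algebra.Generated_Groups"
begin

text \<open>
  The polynomial ring \<open>R[x\<^sub>1,x\<^sub>2]\<close> over \<open>R = 'a\<close> is the type \<open>'a poly poly\<close>, that is \<open>R[x\<^sub>1][x\<^sub>2]\<close>: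
  the inner variable is \<open>x\<^sub>1\<close>, the outer one is \<open>x\<^sub>2\<close>.
\<close>

definition const :: "'a::comm_ring_1 \<Rightarrow> 'a poly poly" where
  "const c = [:[:c:]:]"

definition x1 :: "'a::comm_ring_1 poly poly" where
  "x1 = [:[:0, 1:]:]"

definition x2 :: "'a::comm_ring_1 poly poly" where
  "x2 = [:0, 1:]"

definition in_x1 :: "'a::comm_ring_1 poly \<Rightarrow> 'a poly poly" where
  "in_x1 P = poly (map_poly const P) x1"

definition in_x2 :: "'a::comm_ring_1 poly \<Rightarrow> 'a poly poly" where
  "in_x2 P = poly (map_poly const P) x2"

definition algebra_aut :: "('a::comm_ring_1 poly poly \<Rightarrow> 'a poly poly) \<Rightarrow> bool" where
  "algebra_aut \<phi> \<longleftrightarrow> bij \<phi> \<and>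
     (\<forall>f g. \<phi> (f + g) = \<phi> f + \<phi> g) \<and> (\<forall>f g. \<phi> (f * g) = \<phi> f * \<phi> g) \<and>
     (\<forall>c. \<phi> (const c) = const c)"

definition Aut2 :: "('a::comm_ring_1 poly poly \<Rightarrow> 'a poly poly) monoid" where
  "Aut2 = \<lparr>carrier = {\<phi>. algebra_aut \<phi>}, mult = (\<circ>), one = id\<rparr>"

text \<open>\<open>(\<phi>(x\<^sub>1), \<phi>(x\<^sub>2)) = (x\<^sub>1, x\<^sub>2) M + (b\<^sub>1, b\<^sub>2)\<close>, with row vectors multiplied from the left.\<close>

definition affine_auts :: "('a::comm_ring_1 poly poly \<Rightarrow> 'a poly poly) set" where
  "affine_auts = {\<phi> \<in> carrier Aut2. \<exists>(M :: 'a^2^2) b1 b2. invertible M \<and>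
     \<phi> x1 = x1 * const (M$1$1) + x2 * const (M$2$1) + const b1 \<and>
     \<phi> x2 = x1 * const (M$1$2) + x2 * const (M$2$2) + const b2}"

definition elementary_auts :: "('a::comm_ring_1 poly poly \<Rightarrow> 'a poly poly) set" where
  "elementary_auts = {\<phi> \<in> carrier Aut2. \<exists>a f. a dvd 1 \<and>
     (\<phi> x1 = const a * x1 + in_x2 f \<and> \<phi> x2 = x2 \<or>
      \<phi> x1 = x1 \<and> \<phi> x2 = const a * x2 + in_x1 f)}"

definition tame :: "('a::comm_ring_1 poly poly \<Rightarrow> 'a poly poly) set" where
  "tame = generate Aut2 (affine_auts \<union> elementary_auts)"

definition B_set :: "nat set \<Rightarrow> ('a::comm_ring_1 poly poly \<Rightarrow> 'a poly poly) set" where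
  "B_set I = {\<phi> \<in> carrier Aut2. \<exists>P. (\<forall>i. coeff P i \<noteq> 0 \<longrightarrow> i \<in> I) \<and>
     \<phi> x1 = x1 + in_x2 P \<and> \<phi> x2 = x2}"

definition A_grp :: "nat set \<Rightarrow> ('a::comm_ring_1 poly poly \<Rightarrow> 'a poly poly) set" where
  "A_grp I = generate Aut2 (affine_auts \<union> B_set I)"

text \<open>For \<open>p = 0\<close>, \<open>p dvd m\<close> means \<open>m = 0\<close>.\<close>

definition p_stable :: "nat \<Rightarrow> nat set \<Rightarrow> bool" where
  "p_stable p I \<longleftrightarrow> (\<forall>n\<in>I. \<forall>k. 2 \<le> k \<and> k \<le> n \<longrightarrow> p dvd (n choose k) \<or> k \<in> I)"

definition affine_type_subgroup :: "nat \<Rightarrow> ('a::comm_ring_1 poly poly \<Rightarrow> 'a poly poly) set \<Rightarrow> bool" where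
  "affine_type_subgroup p H \<longleftrightarrow> (\<exists>I. I \<subseteq> {2..} \<and> p_stable p I \<and> H = A_grp I)"

text \<open>
  A set of automorphisms of \<open>R[x\<^sub>1,x\<^sub>2]\<close> is regarded inside the automorphisms of \<open>K[x\<^sub>1,x\<^sub>2]\<close>,
  \<open>K = Frac R\<close>, by taking the \<open>K\<close>-linear extensions of its elements.
\<close>

definition embed :: "'r::idom poly poly \<Rightarrow> 'r fract poly poly" where
  "embed = map_poly (map_poly to_fract)"

definition extend_auts ::
    "('r::idom poly poly \<Rightarrow> 'r poly poly) set \<Rightarrow> ('r fract poly poly \<Rightarrow> 'r fract poly poly) set" where
  "extend_auts S = {\<phi> \<in> carrier Aut2. \<exists>\<psi>\<in>S. \<forall>f. \<phi> (embed f) = embed (\<psi> f)}"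

definition T_grp ::
    "('r::idom fract poly poly \<Rightarrow> 'r fract poly poly) set \<Rightarrow> ('r fract poly poly \<Rightarrow> 'r fract poly poly) set" where
  "T_grp H = generate Aut2 ((H \<inter> extend_auts (carrier Aut2)) \<union> extend_auts tame)"

lemma algebra_aut_inv:
  assumes "algebra_aut \<phi>"
  shows "algebra_aut (inv_into UNIV \<phi>)"
proof -
  have b: "bij \<phi>" using assms by (simp add: algebra_aut_def)
  have *: "\<phi> (inv_into UNIV \<phi> y) = y" for y
    using b by (simp add: bij_is_surj surj_f_inv_f)
  have **: "inv_into UNIV \<phi> y = x \<longleftrightarrow> y = \<phi> x" for x y
    using b by (metis * bij_inv_eq_iff)
  show ?thesis
    using assms b by (simp add: algebra_aut_def ** * bij_imp_bij_inv)
qed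

lemma group_Aut2: "group (Aut2 :: ('a::comm_ring_1 poly poly \<Rightarrow> 'a poly poly) monoid)"
proof (rule groupI)
  fix \<phi> :: "'a poly poly \<Rightarrow> 'a poly poly"
  assume "\<phi> \<in> carrier Aut2"
  hence a: "algebra_aut \<phi>" by (simp add: Aut2_def)
  moreover have "inv_into UNIV \<phi> \<circ> \<phi> = id"
    using a by (simp add: algebra_aut_def bij_is_inj)
  ultimately show "\<exists>\<psi>\<in>carrier Aut2. \<psi> \<otimes>\<^bsub>Aut2\<^esub> \<phi> = \<one>\<^bsub>Aut2\<^esub>"
    using algebra_aut_inv[OF a] by (auto simp: Aut2_def)
qed (auto simp: Aut2_def algebra_aut_def bij_comp comp_assoc)

lemma T_grp_subgroup: "subgroup (T_grp H) Aut2"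
  unfolding T_grp_def
  by (rule group.generate_is_subgroup[OF group_Aut2]) (auto simp: extend_auts_def)

end

theory Submission
  imports Defs
begin

text \<open>
  Let \<open>K\<close> be the fraction field of \<open>R\<close> and write \<open>x = x\<^sub>1\<close>, \<open>y = x\<^sub>2\<close>. The affine group \<open>A\<close> and the group
  \<open>B\<close> of triangular automorphisms \<open>(a x + P(y), c y + d)\<close> generate an amalgamated product over
  \<open>A \<inter> B\<close>: along a word that alternates between \<open>A - B\<close> and \<open>B - A\<close>, the degrees of the two
  images grow (\<open>steep_mult_affine\<close>, \<open>flat_mult_triangular\<close>), so that the word is not the identity.
  Let \<open>C\<close> be the subgroup of those triangular automorphisms whose \<open>P\<close> has all its exponents in
  \<open>I \<union> {0, 1}\<close>; that this is a subgroup is exactly what \<open>p\<close>-stability of \<open>I\<close> gives, since a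
  substitution \<open>y \<mapsto> c y + d\<close> creates \<open>y\<^sup>k\<close> out of \<open>y\<^sup>n\<close> with the factor \<open>n choose k\<close>. The affine type
  subgroup \<open>A_grp I\<close> is generated by \<open>A\<close> and \<open>C\<close>.

  Put \<open>U = A_grp I \<inter> Aut R[x, y]\<close> and \<open>V = B \<inter> Aut R[x, y]\<close>. The tame group over \<open>R\<close> is contained in the
  group generated by \<open>U\<close> and \<open>V\<close> (\<open>extend_tame\<close>), hence so is \<open>T_grp (A_grp I)\<close>. Every element of the
  latter is therefore, up to trivial cases, a word that alternates between \<open>U - V\<close> and \<open>V - U\<close>. A
  factor from \<open>U - V\<close> is not triangular, so it unfolds into an alternating word of \<open>A\<close> and \<open>C\<close> that
  contains a nontriangular affine letter, while a factor from \<open>V - U\<close> lies outside \<open>C\<close> and therefore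
  survives the merging with neighbouring letters from \<open>C\<close>. Now let \<open>\<beta>\<close> be triangular such that no
  \<open>\<beta> v\<close> with \<open>v\<close> in \<open>V\<close> lies in \<open>C\<close>. If a word ends in \<open>\<beta>\<close> and is alternating in \<open>A\<close> and \<open>B\<close>, then
  multiplying it on the right by an element of \<open>\<langle>U, V\<rangle>\<close> cannot cancel the letters in front of \<open>\<beta>\<close>;
  this is \<open>amalgam_words_stay_out\<close>.

  Given \<open>A_grp I\<^sub>1 \<subset> A_grp I\<^sub>2\<close>, there is an exponent \<open>n\<close> in \<open>I\<^sub>2 - I\<^sub>1\<close>. Choose a nonzero nonunit \<open>z\<close> of \<open>R\<close>,
  and put \<open>b = (x + y\<^sup>n / z, y)\<close> and \<open>t = (x, y + z\<^sup>2 x)\<close>. The automorphism \<open>N = b t b\<^sup>-\<^sup>1\<close>, of the type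
  that Nagata considered, has coefficients in \<open>R\<close> (\<open>conj_transvection_integral\<close>), so that \<open>N\<close> lies in
  \<open>T_grp (A_grp I\<^sub>2)\<close>. The swap \<open>s\<close> of the variables lies in \<open>T_grp (A_grp I\<^sub>1)\<close>, and its conjugate
  \<open>N s N\<^sup>-\<^sup>1 = b t b\<^sup>-\<^sup>1 s b t\<^sup>-\<^sup>1 b\<^sup>-\<^sup>1\<close> is an alternating word of \<open>A\<close> and \<open>B\<close> that ends in \<open>\<beta> = b\<^sup>-\<^sup>1\<close>. As
  \<open>1/z\<close> is not in \<open>R\<close> and \<open>n\<close> is not in \<open>I\<^sub>1\<close>, this \<open>\<beta>\<close> has the required property
  (\<open>shear_notin_coset\<close>). Hence the inverse of \<open>N s N\<^sup>-\<^sup>1\<close>, which would cancel the whole word,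
  is not in \<open>T_grp (A_grp I\<^sub>1)\<close>.
\<close>


section \<open>Alternating words in two subgroups\<close>

text \<open>
  The letters come alternately from \<open>U - V\<close> and \<open>V - U\<close>. The two sets are listed in the order that
  puts the one containing the last letter first, so they change places with each letter.
\<close>
inductive alternating :: "('g, 'b) monoid_scheme \<Rightarrow> 'g set \<Rightarrow> 'g set \<Rightarrow> 'g \<Rightarrow> bool" for G where
  letter: "u \<in> U - V \<Longrightarrow> alternating G U V u"
| snoc: "alternating G V U w \<Longrightarrow> u \<in> U - V \<Longrightarrow> alternating G U V (w \<otimes>\<^bsub>G\<^esub> u)"

lemma (in group) alternating_carrier:
  assumes "alternating G U V w" "U \<subseteq> carrier G" "V \<subseteq> carrier G"
  shows "w \<in> carrier G"
  using assms by (induction rule: alternating.induct) auto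

lemma (in group) mult_notin_subgroup:
  assumes "subgroup H G" "x \<in> carrier G" "x \<notin> H" "h \<in> H"
  shows "x \<otimes> h \<notin> H"
proof
  assume xh: "x \<otimes> h \<in> H"
  have h: "h \<in> carrier G" using assms(1,4) by (rule subgroup.mem_carrier)
  have "x \<otimes> h \<otimes> inv h \<in> H"
    using assms(1) xh subgroup.m_inv_closed[OF assms(1,4)] by (rule subgroup.m_closed)
  then show False using assms(2,3) h by (simp add: m_assoc)
qed

text \<open>
  The last letter absorbs an element of the amalgamated subgroup.
\<close>
lemma (in group) alternating_mult_Int:
  assumes U: "subgroup U G" and V: "subgroup V G"
    and w: "alternating G U V w" and h: "h \<in> U \<inter> V"
  shows "alternating G U V (w \<otimes> h)"
  using w
proof cases
  case letter
  then have "w \<otimes> h \<in> U - V"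
    using h mult_notin_subgroup[OF V, of w h] subgroup.m_closed[OF U, of w h]
      subgroup.mem_carrier[OF U, of w] by simp
  then show ?thesis by (rule alternating.letter)
next
  case (snoc v u)
  have "v \<in> carrier G"
    using alternating_carrier[OF snoc(2)] subgroup.subset[OF U] subgroup.subset[OF V] by simp
  hence "w \<otimes> h = v \<otimes> (u \<otimes> h)"
    using snoc(1,3) h subgroup.mem_carrier[OF U, of u] subgroup.mem_carrier[OF U, of h]
    by (simp add: m_assoc)
  moreover have "u \<otimes> h \<in> U - V"
    using snoc(3) h mult_notin_subgroup[OF V, of u h] subgroup.m_closed[OF U, of u h]
      subgroup.mem_carrier[OF U, of u] by simp
  ultimately show ?thesis using alternating.snoc[OF snoc(2), of "u \<otimes> h"] by simp
qed

lemma (in group) reduced_mult: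
  assumes U: "subgroup U G" and V: "subgroup V G" and u: "u \<in> U"
    and w: "w \<in> U \<inter> V \<or> alternating G U V w \<or> alternating G V U w"
  shows "w \<otimes> u \<in> U \<inter> V \<or> alternating G U V (w \<otimes> u) \<or> alternating G V U (w \<otimes> u)"
  using w
proof (elim disjE)
  assume "w \<in> U \<inter> V"
  then have "w \<otimes> u \<in> U" using u U by (simp add: subgroup.m_closed)
  then show ?thesis using alternating.letter[of "w \<otimes> u" U V G] by blast
next
  assume a: "alternating G V U w"
  then show ?thesis
  proof (cases "u \<in> V")
    case True
    then show ?thesis using alternating_mult_Int[OF V U a] u by blast
  next
    case False
    then show ?thesis using alternating.snoc[OF a, of u] u by blast
  qed
next
  assume "alternating G U V w"
  then show ?thesis
  proof cases
    case letter
    then have "w \<otimes> u \<in> U" using u U by (simp add: subgroup.m_closed)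
    then show ?thesis using alternating.letter[of "w \<otimes> u" U V G] by blast
  next
    case (snoc v t)
    have "v \<in> carrier G"
      using alternating_carrier[OF snoc(2)] subgroup.subset[OF U] subgroup.subset[OF V] by simp
    hence e: "w \<otimes> u = v \<otimes> (t \<otimes> u)"
      using snoc(1,3) u subgroup.mem_carrier[OF U, of u] subgroup.mem_carrier[OF U, of t]
      by (simp add: m_assoc)
    have tu: "t \<otimes> u \<in> U" using snoc(3) u U by (simp add: subgroup.m_closed)
    show ?thesis
    proof (cases "t \<otimes> u \<in> V")
      case True
      then show ?thesis using alternating_mult_Int[OF V U snoc(2), of "t \<otimes> u"] tu e by simp
    next
      case False
      then show ?thesis using alternating.snoc[OF snoc(2), of "t \<otimes> u"] tu e by simp
    qed
  qed
qed

text \<open>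
  The set of elements that are in \<open>U \<inter> V\<close> or are alternating words contains the identity and is stable
  under right multiplication by generators (\<open>reduced_mult\<close>), so it contains the generated subgroup.
\<close>
lemma (in group) generate_Un_reduced:
  assumes U: "subgroup U G" and V: "subgroup V G" and g: "g \<in> generate G (U \<union> V)"
  shows "g \<in> U \<inter> V \<or> alternating G U V g \<or> alternating G V U g"
proof -
  define S where "S = {w. w \<in> U \<inter> V \<or> alternating G U V w \<or> alternating G V U w}"
  have c: "S \<subseteq> carrier G"
    using alternating_carrier[of U V] alternating_carrier[of V U]
      subgroup.subset[OF U] subgroup.subset[OF V] unfolding S_def by blast
  have S1: "w \<otimes> u \<in> S" if "w \<in> S" "u \<in> U \<union> V" for w u
    using that reduced_mult[OF U V, of u w] reduced_mult[OF V U, of u w] unfolding S_def by blast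
  have UV: "U \<union> V \<subseteq> carrier G" using U V by (simp add: subgroup.subset)
  have "\<forall>w\<in>S. w \<otimes> g \<in> S"
    using g
  proof (induction rule: generate.induct)
    case one then show ?case using c by auto
  next
    case (incl h) then show ?case using S1 by blast
  next
    case (inv h)
    then have "inv h \<in> U \<union> V"
      using subgroup.m_inv_closed[OF U] subgroup.m_inv_closed[OF V] by blast
    then show ?case using S1 by blast
  next
    case (eng h1 h2)
    then have "h1 \<in> carrier G" "h2 \<in> carrier G"
      using generate_in_carrier[OF UV] by blast+
    then have "w \<otimes> (h1 \<otimes> h2) = w \<otimes> h1 \<otimes> h2" if "w \<in> S" for w
      using that c by (simp add: m_assoc subsetD)
    then show ?case using eng.IH by simp
  qed
  moreover have "\<one> \<in> S" unfolding S_def using U V by (simp add: subgroup.one_closed)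
  moreover have "g \<in> carrier G" using g generate_in_carrier[OF UV] by blast
  ultimately have "g \<in> S" by force
  then show ?thesis unfolding S_def by blast
qed

text \<open>
  The sets \<open>SA\<close> and \<open>SB\<close> are the two sides of a ping-pong for \<open>A\<close> and \<open>B\<close>: a letter from only one
  of the two groups moves one side into the other. The lemma transfers this to \<open>U\<close> and \<open>V\<close>, where \<open>U\<close>
  is made of words in \<open>A\<close> and \<open>C\<close>. The side of \<open>V\<close> becomes \<open>SB' = SA (B - C)\<close>, which absorbs \<open>C\<close> on
  the right, and the side of \<open>U\<close> becomes \<open>SC = SA C\<close>. The hypothesis on \<open>b\<close> puts \<open>f b v\<close> into \<open>SB'\<close>
  for every \<open>v\<close> in \<open>V\<close>, which is where the ping-pong starts.
\<close>
lemma (in group) amalgam_words_stay_out: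
  assumes A: "subgroup A G" and B: "subgroup B G" and C: "subgroup C G"
    and CB: "C \<subseteq> B" and ABC: "A \<inter> B \<subseteq> C"
    and SA: "SA \<subseteq> carrier G"
    and SAB: "\<And>f b. f \<in> SA \<Longrightarrow> b \<in> B - A \<Longrightarrow> f \<otimes> b \<in> SB"
    and SBA: "\<And>f a. f \<in> SB \<Longrightarrow> a \<in> A - B \<Longrightarrow> f \<otimes> a \<in> SA"
    and U: "subgroup U G" and V: "subgroup V G"
    and UAC: "U \<subseteq> generate G (A \<union> C)" and VB: "V \<subseteq> B"
    and UB: "U \<inter> B \<subseteq> V" and VC: "V \<inter> C \<subseteq> U"
    and f: "f \<in> SA" and b: "b \<in> B" and bV: "\<And>v. v \<in> V \<Longrightarrow> b \<otimes> v \<notin> C"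
    and t: "t \<in> generate G (U \<union> V)"
  shows "\<exists>g\<in>SA. \<exists>b'\<in>B. f \<otimes> b \<otimes> t = g \<otimes> b'"
proof -
  have car [simp]: "x \<in> carrier G" if "x \<in> SA \<or> x \<in> A \<or> x \<in> B \<or> x \<in> C \<or> x \<in> U \<or> x \<in> V" for x
    using that SA subgroup.subset[OF A] subgroup.subset[OF B] subgroup.subset[OF C]
      subgroup.subset[OF U] subgroup.subset[OF V] by blast
  define SB' where "SB' = {g \<otimes> b' |g b'. g \<in> SA \<and> b' \<in> B - C}"
  define SC where "SC = {g \<otimes> c |g c. g \<in> SA \<and> c \<in> C}"
  define SC' where "SC' = {g \<otimes> c |g c. g \<in> SA \<and> c \<in> C - A}"
  have SB'_SB: "SB' \<subseteq> SB" unfolding SB'_def using SAB ABC by blast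
  have SC'_SB: "SC' \<subseteq> SB" unfolding SC'_def using SAB CB by blast
  have SB'C: "h \<otimes> c \<in> SB'" if h: "h \<in> SB'" and c: "c \<in> C" for h c
  proof -
    obtain g b' where g: "h = g \<otimes> b'" "g \<in> SA" "b' \<in> B - C" using h SB'_def by auto
    hence "h \<otimes> c = g \<otimes> (b' \<otimes> c)" using c by (simp add: m_assoc)
    moreover have "b' \<otimes> c \<in> B - C"
      using g c CB mult_notin_subgroup[OF C] subgroup.m_closed[OF B] by auto
    ultimately show ?thesis using g SB'_def by blast
  qed
  have SCB: "h \<otimes> v \<in> SB'" if h: "h \<in> SC" and v: "v \<in> B - C" for h v
  proof -
    obtain g c where g: "h = g \<otimes> c" "g \<in> SA" "c \<in> C" using h SC_def by auto
    hence e: "h \<otimes> v = g \<otimes> (c \<otimes> v)" using v by (simp add: m_assoc)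
    have "c \<otimes> v \<in> B" using g v CB subgroup.m_closed[OF B] by auto
    moreover have "c \<otimes> v \<notin> C"
    proof
      assume "c \<otimes> v \<in> C"
      hence "inv c \<otimes> (c \<otimes> v) \<in> C" using g C by (simp add: subgroup.m_closed subgroup.m_inv_closed)
      thus False using g v by (simp add: m_assoc[symmetric])
    qed
    ultimately show ?thesis using g e SB'_def by blast
  qed
  \<comment> \<open>A leading letter from \<open>C\<close> is absorbed by \<open>SB'\<close>; from the first letter in \<open>A\<close> on, the word
    plays the ping-pong of \<open>A\<close> and \<open>B\<close>.\<close>
  have step: "(X = A \<and> Y = C \<longrightarrow> g \<otimes> h \<in> SA) \<and> (X = C \<and> Y = A \<longrightarrow> h \<in> C \<or> g \<otimes> h \<in> SC')"
    if "alternating G X Y h" "(X = A \<and> Y = C) \<or> (X = C \<and> Y = A)" "g \<in> SB'" for X Y h g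
    using that
  proof (induction rule: alternating.induct)
    case (letter u U V)
    have gB: "g \<in> SB" using letter.prems SB'_SB by blast
    show ?case
    proof (intro conjI impI)
      assume "U = A \<and> V = C"
      then have "u \<in> A - B" using letter.hyps ABC by blast
      then show "g \<otimes> u \<in> SA" by (rule SBA[OF gB])
    next
      assume "U = C \<and> V = A"
      then show "u \<in> C \<or> g \<otimes> u \<in> SC'" using letter.hyps by blast
    qed
  next
    case (snoc V U w u)
    have gc: "g \<in> carrier G" using snoc.prems unfolding SB'_def by fastforce
    have "U \<subseteq> carrier G \<and> V \<subseteq> carrier G"
      using snoc.prems subgroup.subset[OF A] subgroup.subset[OF C] by blast
    then have wc: "w \<in> carrier G" and uc: "u \<in> carrier G"
      using alternating_carrier[OF snoc.hyps(1)] snoc.hyps(2) by blast+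
    have e: "g \<otimes> (w \<otimes> u) = g \<otimes> w \<otimes> u" using gc wc uc by (simp add: m_assoc)
    show ?case
    proof (intro conjI impI)
      assume AC: "U = A \<and> V = C"
      then have "w \<in> C \<or> g \<otimes> w \<in> SC'" using snoc.IH snoc.prems by blast
      then have "g \<otimes> w \<in> SB"
        using SB'C[OF snoc.prems(2), of w] SB'_SB SC'_SB by blast
      moreover have "u \<in> A - B" using snoc.hyps(2) AC ABC by blast
      ultimately show "g \<otimes> (w \<otimes> u) \<in> SA" unfolding e by (rule SBA)
    next
      assume CA: "U = C \<and> V = A"
      then have "g \<otimes> w \<in> SA" using snoc.IH snoc.prems by blast
      then have "g \<otimes> w \<otimes> u \<in> SC'" unfolding SC'_def using snoc.hyps(2) CA by blast
      then show "w \<otimes> u \<in> C \<or> g \<otimes> (w \<otimes> u) \<in> SC'" unfolding e by blast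
    qed
  qed
  have SBU: "g \<otimes> u \<in> SC" if g: "g \<in> SB'" and u: "u \<in> U - B" for g u
  proof -
    have "u \<in> A \<inter> C \<or> alternating G A C u \<or> alternating G C A u"
      using generate_Un_reduced[OF A C, of u] UAC u by blast
    moreover have "u \<notin> C" using u CB by blast
    ultimately consider "g \<otimes> u \<in> SA" | "g \<otimes> u \<in> SC'"
      using step[of A C u g] step[of C A u g] g by blast
    then show ?thesis
    proof cases
      case 1
      then have "g \<otimes> u = (g \<otimes> u) \<otimes> \<one>" by simp
      then show ?thesis unfolding SC_def using 1 subgroup.one_closed[OF C] by blast
    qed (auto simp: SC_def SC'_def)
  qed
  have fb: "f \<otimes> b \<in> carrier G" using f b by simp
  have fbV: "f \<otimes> b \<otimes> v \<in> SB'" if v: "v \<in> V" for v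
  proof -
    have "f \<otimes> b \<otimes> v = f \<otimes> (b \<otimes> v)" using f b v by (simp add: m_assoc)
    moreover have "b \<otimes> v \<in> B - C" using b v VB bV subgroup.m_closed[OF B] by auto
    ultimately show ?thesis unfolding SB'_def using f by blast
  qed
  have fb': "f \<otimes> b \<in> SB'" using fbV[of \<one>] fb V by (simp add: subgroup.one_closed)
  \<comment> \<open>A word that starts with a letter of \<open>V\<close> has that letter absorbed by \<open>b\<close>, which is why \<open>h\<close> in \<open>V\<close>
    is the exception in the second case.\<close>
  have main: "(X = U \<and> Y = V \<longrightarrow> f \<otimes> b \<otimes> h \<in> SC) \<and> (X = V \<and> Y = U \<longrightarrow> h \<in> V \<or> f \<otimes> b \<otimes> h \<in> SB')"
    if "alternating G X Y h" "(X = U \<and> Y = V) \<or> (X = V \<and> Y = U)" for X Y h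
    using that
  proof (induction rule: alternating.induct)
    case (letter u U' V')
    then show ?case using SBU[OF fb', of u] UB by blast
  next
    case (snoc V' U' w u)
    have "U' \<subseteq> carrier G \<and> V' \<subseteq> carrier G"
      using snoc.prems subgroup.subset[OF U] subgroup.subset[OF V] by blast
    then have wc: "w \<in> carrier G" and uc: "u \<in> carrier G"
      using alternating_carrier[OF snoc.hyps(1)] snoc.hyps(2) by blast+
    have e: "f \<otimes> b \<otimes> (w \<otimes> u) = f \<otimes> b \<otimes> w \<otimes> u" using fb wc uc by (simp add: m_assoc)
    show ?case
    proof (intro conjI impI)
      assume UV: "U' = U \<and> V' = V"
      then have "f \<otimes> b \<otimes> w \<in> SB'" using snoc.IH fbV by blast
      moreover have "u \<in> U - B" using snoc.hyps(2) UV UB by blast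
      ultimately show "f \<otimes> b \<otimes> (w \<otimes> u) \<in> SC" unfolding e by (rule SBU)
    next
      assume VU: "U' = V \<and> V' = U"
      then have "f \<otimes> b \<otimes> w \<in> SC" using snoc.IH by blast
      moreover have "u \<in> B - C" using snoc.hyps(2) VU VB VC by blast
      ultimately have "f \<otimes> b \<otimes> w \<otimes> u \<in> SB'" by (rule SCB)
      then show "w \<otimes> u \<in> V \<or> f \<otimes> b \<otimes> (w \<otimes> u) \<in> SB'" unfolding e by blast
    qed
  qed
  have "t \<in> V \<or> f \<otimes> b \<otimes> t \<in> SC \<or> f \<otimes> b \<otimes> t \<in> SB'"
    using generate_Un_reduced[OF U V t] main[of U V t] main[of V U t] by blast
  then have "f \<otimes> b \<otimes> t \<in> SC \<union> SB'" using fbV by blast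
  then show ?thesis unfolding SC_def SB'_def using CB by blast
qed


section \<open>Algebra homomorphisms of the polynomial ring in two variables\<close>

lemma const_hom [simp]:
  "const 0 = 0" "const 1 = 1" "const (a + b) = const a + const b"
  "const (a * b) = const a * const b" "const (- a) = - const a" "const (a - b) = const a - const b"
  by (simp_all add: const_def one_pCons)

definition poly_at :: "'a::comm_ring_1 poly \<Rightarrow> 'a poly poly \<Rightarrow> 'a poly poly" where
  "poly_at P t = poly (map_poly const P) t"

lemma in_x_poly_at: "in_x1 P = poly_at P x1" "in_x2 P = poly_at P x2"
  by (simp_all add: in_x1_def in_x2_def poly_at_def)

lemma poly_at_pCons [simp]: "poly_at (pCons c P) t = const c + t * poly_at P t"
  by (simp add: poly_at_def map_poly_pCons)

lemma poly_at_0 [simp]: "poly_at 0 t = 0"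
  by (simp add: poly_at_def)

lemma poly_at_1 [simp]: "poly_at 1 t = 1"
  by (simp add: one_pCons)

lemma poly_at_add [simp]: "poly_at (P + Q) t = poly_at P t + poly_at Q t"
  by (induction P Q rule: poly_induct2) (simp_all add: algebra_simps)

lemma poly_at_smult [simp]: "poly_at (smult c P) t = const c * poly_at P t"
  by (induction P) (simp_all add: algebra_simps)

lemma poly_at_uminus [simp]: "poly_at (- P) t = - poly_at P t"
  by (induction P) (simp_all add: algebra_simps)

lemma poly_at_diff [simp]: "poly_at (P - Q) t = poly_at P t - poly_at Q t"
  using poly_at_add[of P "- Q" t] by simp

lemma poly_at_mult [simp]: "poly_at (P * Q) t = poly_at P t * poly_at Q t"
  by (induction P) (simp_all add: algebra_simps)

lemma poly_at_pcompose: "poly_at (pcompose P Q) t = poly_at P (poly_at Q t)"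
  by (induction P) (simp_all add: pcompose_pCons)

lemma poly_at_monom [simp]: "poly_at (monom c n) t = const c * t ^ n"
  by (induction n) (simp_all add: monom_0 monom_Suc algebra_simps)

lemma poly_at_x1: "poly_at p x1 = [:p:]"
  by (induction p) (simp_all add: const_def x1_def)

lemma poly_at_x2: "poly_at p x2 = map_poly (\<lambda>c. [:c:]) p"
  by (induction p) (simp_all add: const_def x2_def map_poly_pCons)

lemma coeff_poly_at_x2: "coeff (poly_at p x2) k = [:coeff p k:]"
  by (simp add: poly_at_x2 coeff_map_poly)

text \<open>
  Evaluation at \<open>t\<close> is composition with \<open>t\<close> in the outer variable, so degrees multiply.
\<close>
lemma degree_poly_at: "degree (poly_at P t) = degree P * degree t"
  for P :: "'a::idom poly"
proof -
  have "poly_at P t = pcompose (map_poly (\<lambda>c. [:c:]) P) t"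
    by (induction P) (simp_all add: const_def map_poly_pCons pcompose_pCons)
  then show ?thesis by (simp add: degree_pcompose degree_map_poly)
qed

lemma pCons_as_poly_at: "pCons p f = poly_at p x1 + x2 * f"
  by (simp add: poly_at_x1 x2_def)


text \<open>
  The map \<open>\<sigma>\<close> on constants allows the embedding of \<open>R[x, y]\<close> into \<open>K[x, y]\<close>, and the compositions of
  automorphisms with it, to be treated like algebra endomorphisms (\<open>\<sigma> = id\<close>).
\<close>
definition alg_hom :: "('a::comm_ring_1 \<Rightarrow> 'b::comm_ring_1) \<Rightarrow> ('a poly poly \<Rightarrow> 'b poly poly) \<Rightarrow> bool" where
  "alg_hom \<sigma> \<phi> \<longleftrightarrow> (\<forall>f g. \<phi> (f + g) = \<phi> f + \<phi> g) \<and> (\<forall>f g. \<phi> (f * g) = \<phi> f * \<phi> g) \<and>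
     \<phi> 1 = 1 \<and> (\<forall>c. \<phi> (const c) = const (\<sigma> c))"

lemma const_eq_iff [simp]: "const a = const b \<longleftrightarrow> a = b"
  by (simp add: const_def)

lemma alg_homD:
  assumes "alg_hom \<sigma> \<phi>"
  shows "\<phi> (f + g) = \<phi> f + \<phi> g" "\<phi> (f * g) = \<phi> f * \<phi> g" "\<phi> 0 = 0" "\<phi> 1 = 1"
    "\<phi> (const c) = const (\<sigma> c)" "\<phi> (- f) = - \<phi> f" "\<phi> (f - g) = \<phi> f - \<phi> g" "\<phi> (f ^ n) = \<phi> f ^ n"
proof -
  show add: "\<phi> (f + g) = \<phi> f + \<phi> g" for f g using assms by (simp add: alg_hom_def)
  show mult: "\<phi> (f * g) = \<phi> f * \<phi> g" for f g using assms by (simp add: alg_hom_def)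
  show z: "\<phi> 0 = 0" using add[of 0 0] by simp
  show one: "\<phi> 1 = 1" using assms by (simp add: alg_hom_def)
  show "\<phi> (const c) = const (\<sigma> c)" using assms by (simp add: alg_hom_def)
  show um: "\<phi> (- f) = - \<phi> f" for f using add[of f "- f"] z by (simp add: eq_neg_iff_add_eq_0 add.commute)
  show "\<phi> (f - g) = \<phi> f - \<phi> g" using add[of f "- g"] um[of g] by simp
  show "\<phi> (f ^ n) = \<phi> f ^ n" by (induction n) (simp_all add: one mult)
qed

lemma alg_hom_poly_at:
  assumes "alg_hom \<sigma> \<phi>"
  shows "\<phi> (poly_at P t) = poly_at (map_poly \<sigma> P) (\<phi> t)"
proof -
  have "const (\<sigma> 0) = 0" using alg_homD(3,5)[OF assms] by (metis const_hom(1))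
  then have "\<sigma> 0 = 0" using const_eq_iff[of "\<sigma> 0" 0] by simp
  then show ?thesis
    by (induction P) (simp_all add: alg_homD[OF assms] map_poly_pCons)
qed

lemma alg_hom_eqI:
  assumes "alg_hom \<sigma> \<phi>" "alg_hom \<sigma> \<psi>" "\<phi> x1 = \<psi> x1" "\<phi> x2 = \<psi> x2"
  shows "\<phi> f = \<psi> f"
proof (induction f)
  case (pCons p f)
  then show ?case
    using assms by (simp add: pCons_as_poly_at alg_homD[OF assms(1)] alg_homD[OF assms(2)]
        alg_hom_poly_at[OF assms(1)] alg_hom_poly_at[OF assms(2)])
qed (simp add: alg_homD[OF assms(1)] alg_homD[OF assms(2)])

lemma alg_hom_comp: "alg_hom \<tau> \<psi> \<Longrightarrow> alg_hom \<sigma> \<phi> \<Longrightarrow> alg_hom (\<tau> \<circ> \<sigma>) (\<psi> \<circ> \<phi>)"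
  by (simp add: alg_hom_def)

lemma alg_hom_id: "alg_hom id id"
  by (simp add: alg_hom_def)

text \<open>
  The algebra endomorphism with \<open>x \<mapsto> F\<close> and \<open>y \<mapsto> G\<close>.
\<close>
definition subst :: "'a::comm_ring_1 poly poly \<Rightarrow> 'a poly poly \<Rightarrow> 'a poly poly \<Rightarrow> 'a poly poly" where
  "subst F G f = poly (map_poly (\<lambda>p. poly_at p F) f) G"

lemma alg_hom_subst: "alg_hom id (subst F G)"
proof -
  have pC: "subst F G (pCons p f) = poly_at p F + G * subst F G f" for p f
    by (simp add: subst_def map_poly_pCons)
  have z: "subst F G 0 = 0" by (simp add: subst_def)
  have add: "subst F G (f + g) = subst F G f + subst F G g" for f g
    by (induction f g rule: poly_induct2) (simp_all add: pC z algebra_simps)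
  have sm: "subst F G (smult p g) = poly_at p F * subst F G g" for p g
    by (induction g) (simp_all add: pC z algebra_simps)
  have mult: "subst F G (f * g) = subst F G f * subst F G g" for f g
    by (induction f) (simp_all add: pC z add sm algebra_simps)
  have c: "subst F G (const c) = const c" for c
    unfolding const_def pC z by (simp add: const_def)
  show ?thesis unfolding alg_hom_def using add mult c c[of 1] by simp
qed

lemma subst_vars [simp]: "subst F G x1 = F" "subst F G x2 = G"
  by (simp_all add: subst_def x1_def x2_def map_poly_pCons)

lemma mult_Aut2 [simp]: "\<phi> \<otimes>\<^bsub>Aut2\<^esub> \<psi> = \<phi> \<circ> \<psi>" and one_Aut2 [simp]: "\<one>\<^bsub>Aut2\<^esub> = id"
  by (simp_all add: Aut2_def)

lemma carrier_Aut2_iff: "\<phi> \<in> carrier Aut2 \<longleftrightarrow> bij \<phi> \<and> alg_hom id \<phi>"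
  unfolding Aut2_def algebra_aut_def alg_hom_def by (auto) (metis const_hom(2))

lemma carrier_Aut2_hom: "\<phi> \<in> carrier Aut2 \<Longrightarrow> alg_hom id \<phi>"
  by (simp add: carrier_Aut2_iff)

interpretation Aut2: group "Aut2 :: ('a::comm_ring_1 poly poly \<Rightarrow> 'a poly poly) monoid"
  by (rule group_Aut2)

lemma inv_Aut2 [simp]:
  assumes "\<phi> \<in> carrier Aut2"
  shows "\<phi> ((inv\<^bsub>Aut2\<^esub> \<phi>) f) = f" "(inv\<^bsub>Aut2\<^esub> \<phi>) (\<phi> f) = f"
  using fun_cong[OF Aut2.r_inv[OF assms], of f] fun_cong[OF Aut2.l_inv[OF assms], of f] by simp_all

lemma Aut2_eqI:
  assumes "\<phi> \<in> carrier Aut2" "\<psi> \<in> carrier Aut2" "\<phi> x1 = \<psi> x1" "\<phi> x2 = \<psi> x2"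
  shows "\<phi> = \<psi>"
  using alg_hom_eqI[OF carrier_Aut2_hom carrier_Aut2_hom] assms by blast

lemma Aut2_by_inverse:
  assumes h: "alg_hom id \<phi>" "alg_hom id \<psi>"
    and "\<phi> (\<psi> x1) = x1" "\<phi> (\<psi> x2) = x2" "\<psi> (\<phi> x1) = x1" "\<psi> (\<phi> x2) = x2"
  shows "\<phi> \<in> carrier Aut2"
proof -
  have "alg_hom id (\<phi> \<circ> \<psi>)" "alg_hom id (\<psi> \<circ> \<phi>)"
    using alg_hom_comp[OF h] alg_hom_comp[OF h(2,1)] by simp_all
  then have "\<phi> (\<psi> f) = f" "\<psi> (\<phi> f) = f" for f
    using alg_hom_eqI[OF _ alg_hom_id] assms by fastforce+
  then have "bij \<phi>" by (intro o_bij[of \<psi>]) auto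
  then show ?thesis using h by (simp add: carrier_Aut2_iff)
qed


section \<open>Affine automorphisms\<close>

text \<open>
  Matrix entries as a function of both indices, because iterating the infix operator for
  components is ambiguous with the one for coefficients of power series.
\<close>
abbreviation entry :: "'a^'n^'m \<Rightarrow> 'm \<Rightarrow> 'n \<Rightarrow> 'a" where
  "entry M i j \<equiv> vec_nth (vec_nth M i) j"

lemma det_mult_2x2:
  fixes a b c d :: "'a::comm_ring_1"
  shows "(a * d - b * c) * (a' * d' - b' * c') =
    (a * a' + b * c') * (c * b' + d * d') - (a * b' + b * d') * (c * a' + d * c')"
  by (simp add: algebra_simps)

text \<open>
  Over any commutative ring: the determinant is multiplicative, and the adjugate divided by a unit
  determinant is an inverse.
\<close>
lemma invertible_2x2_iff:
  fixes M :: "'a::comm_ring_1^2^2"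
  shows "invertible M \<longleftrightarrow> (entry M 1 1 * entry M 2 2 - entry M 1 2 * entry M 2 1) dvd 1"
proof
  assume "invertible M"
  then obtain N :: "'a^2^2" where "M ** N = mat 1" unfolding invertible_def by blast
  then have e: "(\<Sum>k\<in>UNIV. entry M i k * entry N k j) = (if i = j then 1 else 0)" for i j
    unfolding matrix_matrix_mult_def mat_def vec_eq_iff by simp
  have "entry M 1 1 * entry N 1 1 + entry M 1 2 * entry N 2 1 = 1" "entry M 1 1 * entry N 1 2 + entry M 1 2 * entry N 2 2 = 0"
    "entry M 2 1 * entry N 1 2 + entry M 2 2 * entry N 2 2 = 1"
    using e[of 1 1] e[of 1 2] e[of 2 2] by (simp_all add: sum_2)
  then have "1 = (entry M 1 1 * entry M 2 2 - entry M 1 2 * entry M 2 1) * (entry N 1 1 * entry N 2 2 - entry N 1 2 * entry N 2 1)"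
    by (simp add: det_mult_2x2)
  then show "(entry M 1 1 * entry M 2 2 - entry M 1 2 * entry M 2 1) dvd 1" by (rule dvdI)
next
  assume "(entry M 1 1 * entry M 2 2 - entry M 1 2 * entry M 2 1) dvd 1"
  then obtain u where u: "1 = (entry M 1 1 * entry M 2 2 - entry M 1 2 * entry M 2 1) * u" by (rule dvdE)
  define N :: "'a^2^2" where
    "N = vector [vector [u * entry M 2 2, - (u * entry M 1 2)], vector [- (u * entry M 2 1), u * entry M 1 1]]"
  have N: "entry N 1 1 = u * entry M 2 2" "entry N 1 2 = - (u * entry M 1 2)" "entry N 2 1 = - (u * entry M 2 1)" "entry N 2 2 = u * entry M 1 1"
    by (simp_all add: N_def)
  have "M ** N = mat 1" "N ** M = mat 1"
    unfolding vec_eq_iff forall_2 matrix_matrix_mult_def mat_def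
    using u by (simp_all add: sum_2 N algebra_simps)
  then show "invertible M" unfolding invertible_def by blast
qed

lemma affine_auts_iff:
  "\<phi> \<in> affine_auts \<longleftrightarrow> \<phi> \<in> carrier Aut2 \<and> (\<exists>a b c d e f. (a * d - b * c) dvd 1 \<and>
     \<phi> x1 = const a * x1 + const c * x2 + const e \<and> \<phi> x2 = const b * x1 + const d * x2 + const f)"
    (is "_ \<longleftrightarrow> _ \<and> ?R")
proof -
  have "(\<exists>M :: 'a^2^2. \<exists>b1 b2. invertible M \<and>
     \<phi> x1 = x1 * const (entry M 1 1) + x2 * const (entry M 2 1) + const b1 \<and>
     \<phi> x2 = x1 * const (entry M 1 2) + x2 * const (entry M 2 2) + const b2) \<longleftrightarrow> ?R" (is "?L \<longleftrightarrow> _")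
  proof
    assume ?L
    then obtain M :: "'a^2^2" and b1 b2 where "invertible M"
      "\<phi> x1 = x1 * const (entry M 1 1) + x2 * const (entry M 2 1) + const b1"
      "\<phi> x2 = x1 * const (entry M 1 2) + x2 * const (entry M 2 2) + const b2" by blast
    then have "entry M 1 1 * entry M 2 2 - entry M 1 2 * entry M 2 1 dvd 1"
      "\<phi> x1 = const (entry M 1 1) * x1 + const (entry M 2 1) * x2 + const b1"
      "\<phi> x2 = const (entry M 1 2) * x1 + const (entry M 2 2) * x2 + const b2"
      by (simp_all only: invertible_2x2_iff mult.commute)
    then show ?R by blast
  next
    assume ?R
    then obtain a b c d e f where *: "(a * d - b * c) dvd 1"
      "\<phi> x1 = const a * x1 + const c * x2 + const e" "\<phi> x2 = const b * x1 + const d * x2 + const f"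
      by blast
    then show ?L
      by (intro exI[of _ "vector [vector [a, b], vector [c, d]]"] exI[of _ e] exI[of _ f])
        (simp add: invertible_2x2_iff mult.commute)
  qed
  then show ?thesis unfolding affine_auts_def by blast
qed

lemma affine_autsI:
  assumes "\<phi> \<in> carrier Aut2" "(a * d - b * c) dvd 1"
    "\<phi> x1 = const a * x1 + const c * x2 + const e" "\<phi> x2 = const b * x1 + const d * x2 + const f"
  shows "\<phi> \<in> affine_auts"
  unfolding affine_auts_iff using assms by blast

lemma linear_solve_2x2:
  fixes P Q X Y :: "'a::comm_ring_1"
  assumes X: "X = a * P + c * Q + e" and Y: "Y = b * P + d * Q + f" and u: "1 = (a * d - b * c) * u"
  shows "P = u * d * X + - (u * c) * Y + u * (c * f - d * e)"
    and "Q = - (u * b) * X + u * a * Y + u * (b * e - a * f)"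
proof -
  have "u * d * X + - (u * c) * Y + u * (c * f - d * e) = (a * d - b * c) * u * P"
    "- (u * b) * X + u * a * Y + u * (b * e - a * f) = (a * d - b * c) * u * Q"
    by (simp_all add: X Y algebra_simps)
  then show "P = u * d * X + - (u * c) * Y + u * (c * f - d * e)"
    and "Q = - (u * b) * X + u * a * Y + u * (b * e - a * f)"
    using u by simp_all
qed

text \<open>
  Composition multiplies the matrices, and the inverse is found by solving the two linear equations
  for the images of the variables with Cramer's rule.
\<close>
lemma affine_subgroup: "subgroup affine_auts (Aut2 :: ('a::comm_ring_1 poly poly \<Rightarrow> _) monoid)"
proof (rule Aut2.subgroupI)
  show "affine_auts \<subseteq> carrier (Aut2 :: ('a poly poly \<Rightarrow> _) monoid)" by (auto simp: affine_auts_def)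
  have "id \<in> (affine_auts :: ('a poly poly \<Rightarrow> _) set)"
    using Aut2.one_closed by (intro affine_autsI[of id 1 1 0 0 0 0]) simp_all
  then show "affine_auts \<noteq> ({} :: ('a poly poly \<Rightarrow> _) set)" by blast
next
  fix \<phi> :: "'a poly poly \<Rightarrow> 'a poly poly" assume "\<phi> \<in> affine_auts"
  then obtain a b c d e f where car: "\<phi> \<in> carrier Aut2" and D: "(a * d - b * c) dvd 1"
    and eq: "\<phi> x1 = const a * x1 + const c * x2 + const e" "\<phi> x2 = const b * x1 + const d * x2 + const f"
    unfolding affine_auts_iff by blast
  obtain u where u: "1 = (a * d - b * c) * u" using D by (rule dvdE)
  let ?\<psi> = "inv\<^bsub>Aut2\<^esub> \<phi>"
  have car': "?\<psi> \<in> carrier Aut2" using car by simp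
  note hom = alg_homD[OF carrier_Aut2_hom[OF car']]
  have 1: "x1 = const a * ?\<psi> x1 + const c * ?\<psi> x2 + const e"
    using arg_cong[OF eq(1), of ?\<psi>] car by (simp add: hom)
  have 2: "x2 = const b * ?\<psi> x1 + const d * ?\<psi> x2 + const f"
    using arg_cong[OF eq(2), of ?\<psi>] car by (simp add: hom)
  have U: "1 = (const a * const d - const b * const c) * const u"
    using arg_cong[OF u, of const] by simp
  have "?\<psi> x1 = const (u * d) * x1 + const (- (u * c)) * x2 + const (u * (c * f - d * e))"
    "?\<psi> x2 = const (- (u * b)) * x1 + const (u * a) * x2 + const (u * (b * e - a * f))"
    unfolding const_hom by (rule linear_solve_2x2[OF 1 2 U])+
  moreover have "(u * d) * (u * a) - (- (u * b)) * (- (u * c)) = (a * d - b * c) * u * u"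
    by (simp add: algebra_simps)
  then have "(u * d) * (u * a) - (- (u * b)) * (- (u * c)) dvd 1"
    using u dvd_triv_right[of u "a * d - b * c"] by simp
  ultimately show "?\<psi> \<in> affine_auts"
    using affine_autsI[OF car'] by blast
next
  fix \<phi> \<psi> :: "'a poly poly \<Rightarrow> 'a poly poly" assume "\<phi> \<in> affine_auts" "\<psi> \<in> affine_auts"
  then obtain a b c d e f a' b' c' d' e' f'
    where car: "\<phi> \<in> carrier Aut2" "\<psi> \<in> carrier Aut2"
      and D: "(a * d - b * c) dvd 1" "(a' * d' - b' * c') dvd 1"
      and eq: "\<phi> x1 = const a * x1 + const c * x2 + const e" "\<phi> x2 = const b * x1 + const d * x2 + const f"
        "\<psi> x1 = const a' * x1 + const c' * x2 + const e'" "\<psi> x2 = const b' * x1 + const d' * x2 + const f'"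
    unfolding affine_auts_iff by blast
  note hom = alg_homD[OF carrier_Aut2_hom[OF car(1)]]
  have "(a * a' + b * c') * (c * b' + d * d') - (a * b' + b * d') * (c * a' + d * c')
      = (a * d - b * c) * (a' * d' - b' * c')"
    by (simp only: det_mult_2x2)
  also have "\<dots> dvd 1" using mult_dvd_mono[OF D] by simp
  finally have D': "(a * a' + b * c') * (c * b' + d * d') - (a * b' + b * d') * (c * a' + d * c') dvd 1" .
  have "(\<phi> \<circ> \<psi>) x1 = const (a * a' + b * c') * x1 + const (c * a' + d * c') * x2
      + const (a' * e + c' * f + e')"
    "(\<phi> \<circ> \<psi>) x2 = const (a * b' + b * d') * x1 + const (c * b' + d * d') * x2
      + const (b' * e + d' * f + f')"
    by (simp_all add: eq hom algebra_simps)
  then show "\<phi> \<otimes>\<^bsub>Aut2\<^esub> \<psi> \<in> affine_auts"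
    using Aut2.m_closed[OF car] unfolding mult_Aut2 by (intro affine_autsI[OF _ D'])
qed


section \<open>Triangular automorphisms and \<open>p\<close>-stable exponent sets\<close>

text \<open>
  The exponents \<open>0\<close> and \<open>1\<close> are always admitted, since they belong to the affine part of a triangular
  automorphism.
\<close>
definition affinely_supported :: "nat set \<Rightarrow> 'a::zero poly \<Rightarrow> bool" where
  "affinely_supported I P \<longleftrightarrow> (\<forall>i. coeff P i \<noteq> 0 \<longrightarrow> i \<le> 1 \<or> i \<in> I)"

lemma affinely_supported_smult:
  "affinely_supported I P \<Longrightarrow> affinely_supported I (smult c P)"
  for c :: "'a::comm_semiring_0"
  unfolding affinely_supported_def by (metis coeff_smult mult_zero_right)

lemma affinely_supported_add:
  "affinely_supported I P \<Longrightarrow> affinely_supported I Q \<Longrightarrow> affinely_supported I (P + Q)"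
  for P :: "'a::comm_monoid_add poly"
  unfolding affinely_supported_def by (metis add_0 coeff_add)

text \<open>
  The coefficient of \<open>y\<^sup>k\<close> in \<open>(c y + d)\<^sup>n\<close> is a multiple of \<open>n choose k\<close>; if it does not vanish and
  \<open>k \<ge> 2\<close>, then \<open>p\<close>-stability passes from \<open>n\<close> to \<open>k\<close>.
\<close>
lemma affinely_supported_pcompose_linear:
  fixes P :: "'a::comm_ring_1 poly"
  assumes I: "p_stable CHAR('a) I" and P: "affinely_supported I P"
  shows "affinely_supported I (pcompose P [:d, c:])"
  unfolding affinely_supported_def
proof (intro allI impI)
  fix k assume k: "coeff (pcompose P [:d, c:]) k \<noteq> 0"
  have "pcompose P [:d, c:] = (\<Sum>n\<le>degree P. smult (coeff P n) ([:d, c:] ^ n))"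
    by (simp add: pcompose_altdef poly_altdef degree_map_poly coeff_map_poly)
  then have "coeff (pcompose P [:d, c:]) k = (\<Sum>n\<le>degree P. coeff P n * coeff ([:d, c:] ^ n) k)"
    by (simp add: coeff_sum)
  then obtain n where n: "coeff P n \<noteq> 0" "coeff ([:d, c:] ^ n) k \<noteq> 0"
    using k by (metis (no_types, lifting) mult_zero_left mult_zero_right sum.neutral)
  have "degree ([:d, c:] ^ n) \<le> n"
    using degree_power_le[of "[:d, c:]" n] by (simp split: if_splits)
  then have kn: "k \<le> n" using n(2) by (meson le_degree order_trans)
  then have "of_nat (n choose k) \<noteq> (0 :: 'a)" using n(2) by (auto simp: coeff_linear_poly_power)
  then have "\<not> CHAR('a) dvd (n choose k)" by (simp add: of_nat_eq_0_iff_char_dvd)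
  then have "k \<in> I" if "n \<in> I" "2 \<le> k"
    using I that kn unfolding p_stable_def by blast
  moreover have "n \<le> 1 \<or> n \<in> I" using P n(1) unfolding affinely_supported_def by blast
  ultimately show "k \<le> 1 \<or> k \<in> I" using kn by linarith
qed

definition triangular :: "nat set \<Rightarrow> ('a::field poly poly \<Rightarrow> 'a poly poly) set" where
  "triangular I = {\<phi> \<in> carrier Aut2. \<exists>a P c d. a \<noteq> 0 \<and> c \<noteq> 0 \<and> affinely_supported I P \<and>
     \<phi> x1 = const a * x1 + poly_at P x2 \<and> \<phi> x2 = const c * x2 + const d}"

lemma triangularI:
  assumes "\<phi> \<in> carrier Aut2" "a \<noteq> 0" "c \<noteq> 0" "affinely_supported I P"
    "\<phi> x1 = const a * x1 + poly_at P x2" "\<phi> x2 = const c * x2 + const d"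
  shows "\<phi> \<in> triangular I"
  unfolding triangular_def using assms by blast

lemma triangularE:
  assumes "\<phi> \<in> triangular I"
  obtains a P c d where "\<phi> \<in> carrier Aut2" "a \<noteq> 0" "c \<noteq> 0" "affinely_supported I P"
    "\<phi> x1 = const a * x1 + poly_at P x2" "\<phi> x2 = const c * x2 + const d"
  using assms unfolding triangular_def by blast

lemma Aut2_poly_at:
  assumes "\<phi> \<in> carrier Aut2"
  shows "\<phi> (poly_at P t) = poly_at P (\<phi> t)"
  using alg_hom_poly_at[OF carrier_Aut2_hom[OF assms]] by simp

text \<open>
  The data \<open>a\<close> and \<open>P\<close> of a triangular automorphism can be read off from the image of \<open>x\<close>.
\<close>
lemma coeff_triangular_image:
  "coeff (coeff (const a * x1 + poly_at P x2) k) 0 = coeff P k"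
  "coeff (coeff (const a * x1 + poly_at P x2) 0) 1 = a"
  by (simp_all add: coeff_poly_at_x2 const_def x1_def coeff_pCons split: nat.splits)

lemma triangular_mult_images:
  assumes "\<phi> \<in> carrier Aut2" "\<psi> \<in> carrier Aut2"
    and "\<phi> x1 = const a * x1 + poly_at P x2" "\<phi> x2 = const c * x2 + const d"
    and "\<psi> x1 = const a' * x1 + poly_at P' x2" "\<psi> x2 = const c' * x2 + const d'"
  shows "(\<phi> \<circ> \<psi>) x1 = const (a * a') * x1 + poly_at (smult a' P + pcompose P' [:d, c:]) x2"
    and "(\<phi> \<circ> \<psi>) x2 = const (c * c') * x2 + const (c' * d + d')"
  using assms(3-)
  by (simp_all add: Aut2_poly_at[OF assms(1)] alg_homD[OF carrier_Aut2_hom[OF assms(1)]]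
      poly_at_pcompose algebra_simps)

text \<open>
  Products and inverses substitute a linear polynomial into \<open>P\<close>, which preserves the admitted
  exponents.
\<close>
lemma triangular_subgroup:
  assumes I: "p_stable CHAR('a::field) I"
  shows "subgroup (triangular I) (Aut2 :: ('a poly poly \<Rightarrow> _) monoid)"
proof (rule Aut2.subgroupI)
  show "triangular I \<subseteq> carrier (Aut2 :: ('a poly poly \<Rightarrow> _) monoid)" by (auto simp: triangular_def)
  have "id \<in> (triangular I :: ('a poly poly \<Rightarrow> _) set)"
    using Aut2.one_closed
    by (intro triangularI[of id 1 1 I 0 0]) (simp_all add: affinely_supported_def)
  then show "triangular I \<noteq> ({} :: ('a poly poly \<Rightarrow> _) set)" by blast
next
  fix \<phi> :: "'a poly poly \<Rightarrow> 'a poly poly" assume "\<phi> \<in> triangular I"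
  then obtain a P c d where car: "\<phi> \<in> carrier Aut2" and nz: "a \<noteq> 0" "c \<noteq> 0" and P: "affinely_supported I P"
    and eq: "\<phi> x1 = const a * x1 + poly_at P x2" "\<phi> x2 = const c * x2 + const d"
    by (rule triangularE)
  let ?\<psi> = "inv\<^bsub>Aut2\<^esub> \<phi>"
  have car': "?\<psi> \<in> carrier Aut2" using car by simp
  note hom = alg_homD[OF carrier_Aut2_hom[OF car']] Aut2_poly_at[OF car']
  have 1: "x1 = const a * ?\<psi> x1 + poly_at P (?\<psi> x2)"
    using arg_cong[OF eq(1), of ?\<psi>] car by (simp add: hom)
  have 2: "x2 = const c * ?\<psi> x2 + const d"
    using arg_cong[OF eq(2), of ?\<psi>] car by (simp add: hom)
  have ac: "const (1 / a) * const a = 1" "const (1 / c) * const c = 1"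
    using nz by (simp_all flip: const_hom(4))
  have "const (1 / c) * x2 = (const (1 / c) * const c) * ?\<psi> x2 + const (1 / c) * const d"
    by (subst 2) (simp only: algebra_simps)
  then have y: "?\<psi> x2 = const (1 / c) * x2 + const (- d / c)"
    using ac by (simp flip: const_hom(4))
  have y': "?\<psi> x2 = poly_at [:- d / c, 1 / c:] x2" using y by (simp add: add.commute mult.commute)
  have "const (1 / a) * x1 = (const (1 / a) * const a) * ?\<psi> x1 + const (1 / a) * poly_at P (?\<psi> x2)"
    by (subst 1) (simp only: algebra_simps)
  then have "?\<psi> x1 = const (1 / a) * x1 - const (1 / a) * poly_at P (?\<psi> x2)"
    using ac by simp
  also have "\<dots> = const (1 / a) * x1 + poly_at (smult (- (1 / a)) (pcompose P [:- d / c, 1 / c:])) x2"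
    by (simp only: y' poly_at_smult poly_at_pcompose const_hom(5)) simp
  finally have x: "?\<psi> x1 = const (1 / a) * x1 + poly_at (smult (- (1 / a)) (pcompose P [:- d / c, 1 / c:])) x2" .
  show "?\<psi> \<in> triangular I"
    using nz by (intro triangularI[OF car' _ _ _ x y] affinely_supported_smult
        affinely_supported_pcompose_linear[OF I P]) auto
next
  fix \<phi> \<psi> :: "'a poly poly \<Rightarrow> 'a poly poly"
  assume "\<phi> \<in> triangular I" "\<psi> \<in> triangular I"
  obtain a P c d where 1: "\<phi> \<in> carrier Aut2" "a \<noteq> 0" "c \<noteq> 0" "affinely_supported I P"
    "\<phi> x1 = const a * x1 + poly_at P x2" "\<phi> x2 = const c * x2 + const d"
    using \<open>\<phi> \<in> triangular I\<close> by (rule triangularE)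
  obtain a' P' c' d' where 2: "\<psi> \<in> carrier Aut2" "a' \<noteq> 0" "c' \<noteq> 0" "affinely_supported I P'"
    "\<psi> x1 = const a' * x1 + poly_at P' x2" "\<psi> x2 = const c' * x2 + const d'"
    using \<open>\<psi> \<in> triangular I\<close> by (rule triangularE)
  have supp: "affinely_supported I (smult a' P + pcompose P' [:d, c:])"
    using 1(4) 2(4) I
    by (intro affinely_supported_add affinely_supported_smult affinely_supported_pcompose_linear)
  have car: "\<phi> \<circ> \<psi> \<in> carrier Aut2" using Aut2.m_closed[OF 1(1) 2(1)] by simp
  have nz: "a * a' \<noteq> 0" "c * c' \<noteq> 0" using 1(2,3) 2(2,3) by simp_all
  show "\<phi> \<otimes>\<^bsub>Aut2\<^esub> \<psi> \<in> triangular I"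
    unfolding mult_Aut2
    by (rule triangularI[OF car nz supp triangular_mult_images[OF 1(1) 2(1) 1(5,6) 2(5,6)]])
qed

lemma triangular_mono: "I \<subseteq> J \<Longrightarrow> triangular I \<subseteq> triangular J"
  unfolding triangular_def affinely_supported_def by blast

lemma affine_Int_triangular: "affine_auts \<inter> triangular J \<subseteq> triangular I"
proof
  fix \<phi> :: "'a poly poly \<Rightarrow> 'a poly poly" assume "\<phi> \<in> affine_auts \<inter> triangular J"
  then have "\<phi> \<in> affine_auts" and "\<phi> \<in> triangular J" by blast+
  obtain a P c d where t: "\<phi> \<in> carrier Aut2" "a \<noteq> 0" "c \<noteq> 0"
    "\<phi> x1 = const a * x1 + poly_at P x2" "\<phi> x2 = const c * x2 + const d"
    using \<open>\<phi> \<in> triangular J\<close> by (rule triangularE)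
  obtain a' c' e where e: "\<phi> x1 = const a' * x1 + const c' * x2 + const e"
    using \<open>\<phi> \<in> affine_auts\<close> unfolding affine_auts_iff by blast
  have "const a' * x1 + const c' * x2 + const e = const a' * x1 + poly_at [:e, c':] x2"
    by (simp add: algebra_simps)
  then have "const a * x1 + poly_at P x2 = const a' * x1 + poly_at [:e, c':] x2"
    using t(4) e by metis
  then have "coeff P k = coeff [:e, c':] k" for k
    by (metis coeff_triangular_image(1))
  then have "affinely_supported I P"
    by (simp add: affinely_supported_def coeff_pCons split: nat.splits)
  then show "\<phi> \<in> triangular I" using t by (intro triangularI)
qed


section \<open>The degree in the second variable\<close>

text \<open>
  The two sides of the ping-pong for the affine and the triangular group. The degree is the one in
  \<open>y\<close> alone; it serves as well as the total degree, as only its behaviour under sums and products matters.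
  The bound \<open>2\<close> keeps the identity away from \<open>flat\<close>, also after a further triangular factor, as such a
  factor does not change the degree of the image of \<open>y\<close>.
\<close>
definition flat :: "('a::field poly poly \<Rightarrow> 'a poly poly) set" where
  "flat = {\<phi> \<in> carrier Aut2. degree (\<phi> x1) \<le> degree (\<phi> x2) \<and> 2 \<le> degree (\<phi> x2)}"

definition steep :: "('a::field poly poly \<Rightarrow> 'a poly poly) set" where
  "steep = {\<phi> \<in> carrier Aut2. degree (\<phi> x2) < degree (\<phi> x1) \<and> 1 \<le> degree (\<phi> x2)}"

lemma degree_const_mult: "a \<noteq> 0 \<Longrightarrow> degree (const a * f) = degree f" for a :: "'a::idom"
  by (simp add: const_def)

lemma degree_const_mult_le: "degree (const a * f) \<le> degree f"
  by (simp add: const_def degree_smult_le)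

lemma degree_const [simp]: "degree (const a) = 0"
  by (simp add: const_def)

lemma degree_affine_combination:
  fixes a :: "'a::idom"
  assumes "a \<noteq> 0" "degree g < degree f"
  shows "degree (const a * f + const b * g + const e) = degree f"
proof -
  have "degree (const b * g) < degree f" using degree_const_mult_le[of b g] assms(2) by linarith
  then show ?thesis
    using assms degree_add_eq_left[of "const b * g" "const a * f"]
      degree_add_eq_left[of "const e" "const a * f + const b * g"]
    by (simp add: degree_const_mult)
qed

text \<open>
  A nontriangular affine letter sends \<open>y\<close> to \<open>b x + d y + f\<close> with \<open>b \<noteq> 0\<close>, and the image of \<open>x\<close>
  dominates.
\<close>
lemma steep_mult_affine:
  assumes f: "\<phi> \<in> steep" and a: "\<alpha> \<in> affine_auts - triangular UNIV"
  shows "\<phi> \<circ> \<alpha> \<in> flat"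
proof -
  have car: "\<phi> \<in> carrier Aut2" and deg: "degree (\<phi> x2) < degree (\<phi> x1)" "1 \<le> degree (\<phi> x2)"
    using f by (auto simp: steep_def)
  have "\<alpha> \<in> affine_auts" using a by blast
  then obtain a b c d e f where al: "\<alpha> \<in> carrier Aut2" and D: "(a * d - b * c) dvd 1"
    and eq: "\<alpha> x1 = const a * x1 + const c * x2 + const e" "\<alpha> x2 = const b * x1 + const d * x2 + const f"
    unfolding affine_auts_iff by blast
  note hom = alg_homD[OF carrier_Aut2_hom[OF car]]
  have "b \<noteq> 0"
  proof
    assume b: "b = 0"
    have "\<alpha> x1 = const a * x1 + poly_at [:e, c:] x2" "\<alpha> x2 = const d * x2 + const f"
      using eq b by (simp_all add: algebra_simps)
    moreover have "a \<noteq> 0" "d \<noteq> 0" using D b by auto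
    ultimately have "\<alpha> \<in> triangular UNIV"
      using al by (intro triangularI[of \<alpha> a d UNIV "[:e, c:]"]) (simp_all add: affinely_supported_def)
    then show False using a by blast
  qed
  then have y: "degree ((\<phi> \<circ> \<alpha>) x2) = degree (\<phi> x1)"
    using degree_affine_combination[OF _ deg(1)] by (simp add: eq hom)
  have "degree ((\<phi> \<circ> \<alpha>) x1) \<le> degree (\<phi> x1)"
    using deg(1) degree_const_mult_le[of a "\<phi> x1"] degree_const_mult_le[of c "\<phi> x2"]
    by (simp add: eq hom) (intro degree_add_le; simp)
  then show ?thesis
    unfolding flat_def using y deg Aut2.m_closed[OF car al] by simp
qed

text \<open>
  Here \<open>P\<close> has degree at least two, and \<open>P\<close> of the image of \<open>y\<close> dominates. The lower bound on the
  degree is weaker than in \<open>flat\<close> so that \<open>\<phi>\<close> may be the identity, from which the ping-pong starts.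
\<close>
lemma flat_mult_triangular:
  assumes car: "\<phi> \<in> carrier Aut2" and deg: "degree (\<phi> x1) \<le> degree (\<phi> x2)" "1 \<le> degree (\<phi> x2)"
    and b: "\<beta> \<in> triangular UNIV - affine_auts"
  shows "\<phi> \<circ> \<beta> \<in> steep"
proof -
  have "\<beta> \<in> triangular UNIV" using b by blast
  then obtain a P c d where be: "\<beta> \<in> carrier Aut2" and nz: "a \<noteq> 0" "c \<noteq> 0"
    and eq: "\<beta> x1 = const a * x1 + poly_at P x2" "\<beta> x2 = const c * x2 + const d"
    by (rule triangularE)
  note hom = alg_homD[OF carrier_Aut2_hom[OF car]] Aut2_poly_at[OF car]
  have P: "degree P \<ge> 2"
  proof (rule ccontr)
    assume "\<not> degree P \<ge> 2"
    then have "coeff P k = coeff [:coeff P 0, coeff P 1:] k" for k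
      by (auto simp: coeff_pCons coeff_eq_0 split: nat.splits)
    then have "P = [:coeff P 0, coeff P 1:]" by (rule poly_eqI)
    then have "\<beta> x1 = const a * x1 + poly_at [:coeff P 0, coeff P 1:] x2" using eq by metis
    then have "\<beta> \<in> affine_auts"
      using be nz eq
      by (intro affine_autsI[of \<beta> a c 0 "coeff P 1" "coeff P 0" d]) (simp_all add: algebra_simps dvd_field_iff)
    then show False using b by blast
  qed
  have y: "degree ((\<phi> \<circ> \<beta>) x2) = degree (\<phi> x2)"
    using nz degree_add_eq_left[of "const d" "const c * \<phi> x2"] deg
    by (simp add: eq hom degree_const_mult)
  have "1 * degree (\<phi> x2) < degree P * degree (\<phi> x2)"
    using P deg by (intro mult_strict_right_mono) simp_all
  then have lt: "degree (\<phi> x2) < degree P * degree (\<phi> x2)" by simp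
  then have "degree ((\<phi> \<circ> \<beta>) x1) = degree P * degree (\<phi> x2)"
    using nz deg le_less_trans[OF deg(1) lt] degree_add_eq_right[of "const a * \<phi> x1" "poly_at P (\<phi> x2)"]
    by (simp add: eq hom degree_const_mult degree_poly_at)
  then show ?thesis
    unfolding steep_def using y deg lt Aut2.m_closed[OF car be] by simp
qed


section \<open>Automorphisms defined over the subring\<close>

lemma alg_hom_embed: "alg_hom to_fract embed"
proof -
  have add: "embed (f + g) = embed f + embed g" for f g :: "'a poly poly"
    by (intro poly_eqI) (simp add: embed_def coeff_map_poly)
  have 0: "embed (0 :: 'a poly poly) = 0" by (simp add: embed_def)
  have pC: "embed (pCons p f) = pCons (map_poly to_fract p) (embed f)" for p and f :: "'a poly poly"
    by (simp add: embed_def map_poly_pCons)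
  have inner: "map_poly to_fract (p * q) = map_poly to_fract p * map_poly to_fract q" for p q :: "'a poly"
    by (intro poly_eqI) (simp add: coeff_map_poly coeff_mult)
  have inner_add: "map_poly to_fract (p + q) = map_poly to_fract p + map_poly to_fract q" for p q :: "'a poly"
    by (intro poly_eqI) (simp add: coeff_map_poly)
  have sm: "embed (smult p g) = smult (map_poly to_fract p) (embed g)" for p and g :: "'a poly poly"
    by (intro poly_eqI) (simp add: embed_def coeff_map_poly inner)
  have mult: "embed (f * g) = embed f * embed g" for f g :: "'a poly poly"
    by (induction f) (simp_all add: 0 pC add sm)
  have c: "embed (const c) = const (to_fract c)" for c :: 'a
    by (simp add: const_def pC 0 map_poly_pCons)
  show ?thesis unfolding alg_hom_def using add mult c c[of 1] by simp
qed

lemmas embed_simps = alg_homD[OF alg_hom_embed]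

lemma embed_vars [simp]: "embed x1 = x1" "embed x2 = x2"
  by (simp_all add: embed_def x1_def x2_def map_poly_pCons)

lemma coeff_embed: "coeff (coeff (embed f) i) j = to_fract (coeff (coeff f i) j)"
  by (simp add: embed_def coeff_map_poly)

lemma embed_inject: "embed f = embed g \<longleftrightarrow> f = g"
  by (metis coeff_embed poly_eqI to_fract_eq_iff)

text \<open>
  Both sides are homomorphisms from \<open>R[x, y]\<close> to \<open>K[x, y]\<close>, so two values decide.
\<close>
lemma extension_by_images:
  assumes \<phi>: "alg_hom id \<phi>" and \<psi>: "alg_hom id \<psi>"
    and "\<phi> x1 = embed (\<psi> x1)" "\<phi> x2 = embed (\<psi> x2)"
  shows "\<phi> (embed f) = embed (\<psi> f)"
proof -
  have "alg_hom to_fract (\<phi> \<circ> embed)" "alg_hom to_fract (embed \<circ> \<psi>)"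
    using alg_hom_comp[OF \<phi> alg_hom_embed] alg_hom_comp[OF alg_hom_embed \<psi>] by simp_all
  then have "(\<phi> \<circ> embed) f = (embed \<circ> \<psi>) f" by (rule alg_hom_eqI) (simp_all add: assms)
  then show ?thesis by simp
qed

lemma extension_exists:
  assumes "\<psi> \<in> carrier Aut2"
  shows "\<exists>\<phi>\<in>carrier Aut2. \<forall>f. \<phi> (embed f) = embed (\<psi> f)"
proof -
  let ?ext = "\<lambda>\<psi>. subst (embed (\<psi> x1)) (embed (\<psi> x2))"
  let ?\<psi>' = "inv\<^bsub>Aut2\<^esub> \<psi>"
  have car: "?\<psi>' \<in> carrier Aut2" using assms by simp
  have e: "?ext \<psi> (embed f) = embed (\<psi> f)" "?ext ?\<psi>' (embed f) = embed (?\<psi>' f)" for f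
    using extension_by_images[OF alg_hom_subst carrier_Aut2_hom[OF assms]]
      extension_by_images[OF alg_hom_subst carrier_Aut2_hom[OF car]] by simp_all
  have "?ext \<psi> \<in> carrier Aut2"
    using e[of "?\<psi>' x1"] e[of "?\<psi>' x2"] e[of "\<psi> x1"] e[of "\<psi> x2"] assms
    by (intro Aut2_by_inverse[of _ "?ext ?\<psi>'"] alg_hom_subst) simp_all
  then show ?thesis using e by blast
qed

lemma extension_unique:
  assumes "\<phi> \<in> carrier Aut2" "\<phi>' \<in> carrier Aut2"
    and "\<forall>f. \<phi> (embed f) = embed (\<psi> f)" "\<forall>f. \<phi>' (embed f) = embed (\<psi> f)"
  shows "\<phi> = \<phi>'"
  using assms(3)[rule_format, of x1] assms(3)[rule_format, of x2]
    assms(4)[rule_format, of x1] assms(4)[rule_format, of x2]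
  by (intro Aut2_eqI[OF assms(1,2)]) simp_all

lemma extension_inv:
  assumes "\<phi> \<in> carrier Aut2" "\<psi> \<in> carrier Aut2" "\<forall>f. \<phi> (embed f) = embed (\<psi> f)"
  shows "(inv\<^bsub>Aut2\<^esub> \<phi>) (embed f) = embed ((inv\<^bsub>Aut2\<^esub> \<psi>) f)"
proof -
  have "\<phi> (embed ((inv\<^bsub>Aut2\<^esub> \<psi>) f)) = embed f" using assms by simp
  then show ?thesis using inv_Aut2(2)[OF assms(1)] by metis
qed

lemma id_carrier: "id \<in> carrier Aut2"
  using Aut2.one_closed by simp

lemma extend_auts_mono: "S \<subseteq> S' \<Longrightarrow> extend_auts S \<subseteq> extend_auts S'"
  unfolding extend_auts_def by blast

text \<open>
  Extension to \<open>K[x, y]\<close> is a well-defined injective homomorphism, so it maps generated subgroups to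
  generated subgroups.
\<close>
lemma extend_auts_generate:
  assumes S: "S \<subseteq> carrier Aut2" and W: "subgroup W Aut2" and sub: "extend_auts S \<subseteq> W"
  shows "extend_auts (generate Aut2 S) \<subseteq> W"
proof
  fix \<phi> assume "\<phi> \<in> extend_auts (generate Aut2 S)"
  then obtain \<psi> where \<phi>: "\<phi> \<in> carrier Aut2" and \<psi>: "\<psi> \<in> generate Aut2 S"
    and ext: "\<forall>f. \<phi> (embed f) = embed (\<psi> f)"
    unfolding extend_auts_def by blast
  show "\<phi> \<in> W" using \<psi> \<phi> ext
  proof (induction arbitrary: \<phi> rule: generate.induct)
    case one
    then have "\<phi> = id" using id_carrier by (intro extension_unique[of _ _ id]) simp_all
    moreover have "id \<in> W" using subgroup.one_closed[OF W] unfolding one_Aut2 .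
    ultimately show ?case by (simp only:)
  next
    case (incl h)
    then show ?case using sub unfolding extend_auts_def by blast
  next
    case (inv h)
    have h: "h \<in> carrier Aut2" using inv.hyps S by blast
    have "\<forall>f. (inv\<^bsub>Aut2\<^esub> \<phi>) (embed f) = embed (h f)"
      using extension_inv[OF inv.prems(1) _ inv.prems(2)] h by simp
    then have "inv\<^bsub>Aut2\<^esub> \<phi> \<in> W"
      using sub inv.hyps inv.prems(1) Aut2.inv_closed unfolding extend_auts_def by blast
    then show ?case using subgroup.m_inv_closed[OF W] inv.prems(1) by fastforce
  next
    case (eng h1 h2)
    have "h1 \<in> carrier Aut2" "h2 \<in> carrier Aut2"
      using eng.hyps Aut2.generate_in_carrier[OF S] by blast+
    then obtain \<phi>1 \<phi>2 where 1: "\<phi>1 \<in> carrier Aut2" "\<forall>f. \<phi>1 (embed f) = embed (h1 f)"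
      and 2: "\<phi>2 \<in> carrier Aut2" "\<forall>f. \<phi>2 (embed f) = embed (h2 f)"
      using extension_exists by metis
    have "\<phi> = \<phi>1 \<otimes>\<^bsub>Aut2\<^esub> \<phi>2"
      using eng.prems 1 2 by (intro extension_unique[OF _ Aut2.m_closed, of _ _ _ "h1 \<circ> h2"]) simp_all
    then show ?case using eng.IH(1)[OF 1] eng.IH(2)[OF 2] subgroup.m_closed[OF W] by (simp only:)
  qed
qed

lemma integral_subgroup: "subgroup (extend_auts (carrier Aut2)) Aut2"
proof (rule Aut2.subgroupI)
  show "extend_auts (carrier Aut2) \<subseteq> carrier Aut2" by (auto simp: extend_auts_def)
  have "id \<in> extend_auts (carrier Aut2)"
    unfolding extend_auts_def mem_Collect_eq
    by (intro conjI id_carrier bexI[OF _ id_carrier] allI) simp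
  then show "extend_auts (carrier Aut2) \<noteq> {}" by blast
next
  fix \<phi> :: "'a fract poly poly \<Rightarrow> 'a fract poly poly" assume "\<phi> \<in> extend_auts (carrier Aut2)"
  then obtain \<psi> where "\<phi> \<in> carrier Aut2" "\<psi> \<in> carrier Aut2" "\<forall>f. \<phi> (embed f) = embed (\<psi> f)"
    unfolding extend_auts_def by blast
  then show "inv\<^bsub>Aut2\<^esub> \<phi> \<in> extend_auts (carrier Aut2)"
    unfolding extend_auts_def using extension_inv[of \<phi> \<psi>] Aut2.inv_closed by blast
next
  fix \<phi> \<phi>' :: "'a fract poly poly \<Rightarrow> 'a fract poly poly"
  assume "\<phi> \<in> extend_auts (carrier Aut2)" "\<phi>' \<in> extend_auts (carrier Aut2)"
  then obtain \<psi> \<psi>' where *: "\<phi> \<in> carrier Aut2" "\<psi> \<in> carrier Aut2" "\<forall>f. \<phi> (embed f) = embed (\<psi> f)"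
    "\<phi>' \<in> carrier Aut2" "\<psi>' \<in> carrier Aut2" "\<forall>f. \<phi>' (embed f) = embed (\<psi>' f)"
    unfolding extend_auts_def by blast
  have "\<forall>f. (\<phi> \<otimes>\<^bsub>Aut2\<^esub> \<phi>') (embed f) = embed ((\<psi> \<otimes>\<^bsub>Aut2\<^esub> \<psi>') f)" using * by simp
  then show "\<phi> \<otimes>\<^bsub>Aut2\<^esub> \<phi>' \<in> extend_auts (carrier Aut2)"
    unfolding extend_auts_def using Aut2.m_closed[OF *(1,4)] Aut2.m_closed[OF *(2,5)] by blast
qed

text \<open>
  If an automorphism and its inverse send the variables into \<open>R[x, y]\<close>, then the two substitutions
  over \<open>R\<close> with the same images are inverse to each other.
\<close>
lemma integralI:
  assumes car: "\<phi> \<in> carrier Aut2"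
    and "\<phi> x1 \<in> range embed" "\<phi> x2 \<in> range embed"
    and "(inv\<^bsub>Aut2\<^esub> \<phi>) x1 \<in> range embed" "(inv\<^bsub>Aut2\<^esub> \<phi>) x2 \<in> range embed"
  shows "\<phi> \<in> extend_auts (carrier Aut2)"
proof -
  obtain F G F' G' where F: "\<phi> x1 = embed F" "\<phi> x2 = embed G"
    "(inv\<^bsub>Aut2\<^esub> \<phi>) x1 = embed F'" "(inv\<^bsub>Aut2\<^esub> \<phi>) x2 = embed G'"
    using assms by blast
  have car': "inv\<^bsub>Aut2\<^esub> \<phi> \<in> carrier Aut2" using car by simp
  have e: "\<phi> (embed f) = embed (subst F G f)" "(inv\<^bsub>Aut2\<^esub> \<phi>) (embed f) = embed (subst F' G' f)" for f
    using extension_by_images[OF carrier_Aut2_hom[OF car] alg_hom_subst]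
      extension_by_images[OF carrier_Aut2_hom[OF car'] alg_hom_subst] F by simp_all
  have "embed (subst F G (subst F' G' f)) = embed f" "embed (subst F' G' (subst F G f)) = embed f" for f
    using car by (simp_all flip: e)
  then have "subst F G \<in> carrier Aut2"
    unfolding embed_inject by (intro Aut2_by_inverse[of _ "subst F' G'"] alg_hom_subst)
  then show ?thesis unfolding extend_auts_def using car e by blast
qed

definition swap :: "'a::comm_ring_1 poly poly \<Rightarrow> 'a poly poly" where
  "swap = subst x2 x1"

lemma swap_vars [simp]: "swap x1 = x2" "swap x2 = x1"
  by (simp_all add: swap_def)

lemma swap_carrier: "swap \<in> carrier Aut2"
  using alg_hom_subst[of x2 x1] by (intro Aut2_by_inverse[of _ swap]) (simp_all flip: swap_def)

lemma swap_swap: "swap \<circ> swap = id"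
  using Aut2.m_closed[OF swap_carrier swap_carrier] Aut2.one_closed
  by (intro Aut2_eqI) simp_all

lemma inv_swap: "inv\<^bsub>Aut2\<^esub> swap = swap"
  using Aut2.inv_equality[of swap swap] swap_swap swap_carrier by simp

lemma swap_affine: "swap \<in> affine_auts"
  by (rule affine_autsI[OF swap_carrier, of 0 0 1 1 0 0]) simp_all

lemma swap_integral: "swap \<in> extend_auts (carrier Aut2)"
  using rangeI[of embed x1] rangeI[of embed x2]
  by (intro integralI[OF swap_carrier]) (simp_all add: inv_swap)

text \<open>
  A unit determinant in \<open>R\<close> stays a unit in \<open>K\<close>.
\<close>
lemma extend_affine: "extend_auts affine_auts \<subseteq> affine_auts"
proof
  fix \<phi> :: "'a fract poly poly \<Rightarrow> 'a fract poly poly" assume "\<phi> \<in> extend_auts affine_auts"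
  then obtain \<psi> where \<phi>: "\<phi> \<in> carrier Aut2" "\<psi> \<in> affine_auts" "\<forall>f. \<phi> (embed f) = embed (\<psi> f)"
    unfolding extend_auts_def by blast
  then obtain a b c d e f where D: "(a * d - b * c) dvd 1"
    and eq: "\<psi> x1 = const a * x1 + const c * x2 + const e" "\<psi> x2 = const b * x1 + const d * x2 + const f"
    unfolding affine_auts_iff by blast
  have "to_fract a * to_fract d - to_fract b * to_fract c = to_fract (a * d - b * c)" by simp
  also have "\<dots> dvd 1" using D by (metis dvd_def to_fract_1 to_fract_mult)
  finally show "\<phi> \<in> affine_auts"
    using \<phi>(3)[rule_format, of x1] \<phi>(3)[rule_format, of x2]
    by (intro affine_autsI[OF \<phi>(1)]) (simp_all add: eq embed_simps)
qed


section \<open>Tame automorphisms\<close>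

lemma triangular_integral_coeffs:
  assumes v: "v \<in> triangular I \<inter> extend_auts (carrier Aut2)"
    and vx: "v x1 = const a * x1 + poly_at P x2"
  shows "a \<in> range to_fract" "coeff P k \<in> range to_fract"
proof -
  obtain \<psi> where \<psi>: "\<forall>f. v (embed f) = embed (\<psi> f)"
    using v unfolding extend_auts_def by blast
  define F where "F = \<psi> x1"
  have "v x1 = embed F" using \<psi>[rule_format, of x1] by (simp add: F_def)
  then have *: "coeff (coeff (const a * x1 + poly_at P x2) i) j = to_fract (coeff (coeff F i) j)" for i j
    using vx by (simp only: coeff_embed)
  show "a \<in> range to_fract" using *[of 0 1] unfolding coeff_triangular_image by blast
  show "coeff P k \<in> range to_fract" using *[of k 0] unfolding coeff_triangular_image by blast
qed

text \<open>
  The inverse of \<open>v\<close> is also triangular over \<open>R\<close>, and the coefficients of \<open>x\<close> multiply.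
\<close>
lemma triangular_integral_unit:
  assumes v: "v \<in> triangular UNIV \<inter> extend_auts (carrier Aut2)"
    and vx: "v x1 = const a * x1 + poly_at P x2"
  shows "\<exists>s. a * to_fract s = 1"
proof -
  have V: "subgroup (triangular UNIV \<inter> extend_auts (carrier Aut2)) (Aut2 :: ('a fract poly poly \<Rightarrow> _) monoid)"
    by (intro Aut2.subgroups_Inter_pair triangular_subgroup integral_subgroup) (simp add: p_stable_def)
  have iv: "inv\<^bsub>Aut2\<^esub> v \<in> triangular UNIV \<inter> extend_auts (carrier Aut2)"
    using subgroup.m_inv_closed[OF V v] .
  have "v \<in> triangular UNIV" "inv\<^bsub>Aut2\<^esub> v \<in> triangular UNIV" using v iv by blast+
  obtain a0 P0 c d where 1: "v \<in> carrier Aut2" "v x1 = const a0 * x1 + poly_at P0 x2" "v x2 = const c * x2 + const d"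
    using \<open>v \<in> triangular UNIV\<close> by (rule triangularE)
  obtain a' P' c' d' where 2: "inv\<^bsub>Aut2\<^esub> v \<in> carrier Aut2" "(inv\<^bsub>Aut2\<^esub> v) x1 = const a' * x1 + poly_at P' x2"
    "(inv\<^bsub>Aut2\<^esub> v) x2 = const c' * x2 + const d'"
    using \<open>inv\<^bsub>Aut2\<^esub> v \<in> triangular UNIV\<close> by (rule triangularE)
  have "(v \<circ> inv\<^bsub>Aut2\<^esub> v) x1 = x1" using 1(1) by simp
  then have "const (a * a') * x1 + poly_at (smult a' P + pcompose P' [:d, c:]) x2 = const 1 * x1 + poly_at 0 x2"
    using triangular_mult_images(1)[OF 1(1) 2(1) vx 1(3) 2(2,3)] by simp
  then have "a * a' = 1" by (metis coeff_triangular_image(2))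
  moreover have "a' \<in> range to_fract" using triangular_integral_coeffs(1)[OF iv 2(2)] .
  ultimately show ?thesis by blast
qed

lemma elementary_carrier: "elementary_auts \<subseteq> carrier Aut2"
  and affine_carrier: "affine_auts \<subseteq> carrier Aut2"
  unfolding elementary_auts_def affine_auts_def by blast+

text \<open>
  An elementary automorphism that changes \<open>y\<close> becomes triangular after conjugation with the swap.
\<close>
lemma extend_elementary:
  assumes "subgroup W Aut2" "swap \<in> W" "triangular UNIV \<inter> extend_auts (carrier Aut2) \<subseteq> W"
  shows "extend_auts elementary_auts \<subseteq> W"
proof
  fix \<phi> :: "'a fract poly poly \<Rightarrow> 'a fract poly poly"
  assume \<phi>_ext: "\<phi> \<in> extend_auts elementary_auts"
  then have \<phi>_int: "\<phi> \<in> extend_auts (carrier Aut2)"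
    using extend_auts_mono[OF elementary_carrier] by blast
  obtain \<psi> where \<phi>: "\<phi> \<in> carrier Aut2" "\<psi> \<in> elementary_auts" "\<forall>f. \<phi> (embed f) = embed (\<psi> f)"
    using \<phi>_ext unfolding extend_auts_def by blast
  obtain a f where a: "a dvd 1" and cases: "\<psi> x1 = const a * x1 + in_x2 f \<and> \<psi> x2 = x2 \<or>
      \<psi> x1 = x1 \<and> \<psi> x2 = const a * x2 + in_x1 f"
    using \<phi>(2) unfolding elementary_auts_def by blast
  let ?a = "to_fract a" and ?f = "map_poly to_fract f"
  have a0: "?a \<noteq> 0" using a by auto
  have vars: "\<phi> x1 = embed (\<psi> x1)" "\<phi> x2 = embed (\<psi> x2)"
    using \<phi>(3)[rule_format, of x1] \<phi>(3)[rule_format, of x2] by simp_all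
  have supp: "affinely_supported UNIV ?f" by (simp add: affinely_supported_def)
  have shape: "embed (const a * x1 + in_x2 f) = const ?a * x1 + poly_at ?f x2"
    "embed (const a * x2 + in_x1 f) = const ?a * x2 + poly_at ?f x1"
    by (simp_all add: embed_simps in_x_poly_at alg_hom_poly_at[OF alg_hom_embed])
  from cases show "\<phi> \<in> W"
  proof
    assume "\<psi> x1 = const a * x1 + in_x2 f \<and> \<psi> x2 = x2"
    then have "\<phi> x1 = const ?a * x1 + poly_at ?f x2" "\<phi> x2 = const 1 * x2 + const 0"
      using vars shape by simp_all
    then have "\<phi> \<in> triangular UNIV" by (rule triangularI[OF \<phi>(1) a0 one_neq_zero supp])
    then show ?thesis using assms(3) \<phi>_int by blast
  next
    assume "\<psi> x1 = x1 \<and> \<psi> x2 = const a * x2 + in_x1 f"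
    then have e: "\<phi> x1 = x1" "\<phi> x2 = const ?a * x2 + poly_at ?f x1"
      using vars shape by simp_all
    let ?\<tau> = "swap \<otimes>\<^bsub>Aut2\<^esub> \<phi> \<otimes>\<^bsub>Aut2\<^esub> swap"
    have car: "?\<tau> \<in> carrier Aut2" using \<phi>(1) swap_carrier Aut2.m_closed by blast
    have "?\<tau> x1 = const ?a * x1 + poly_at ?f x2" "?\<tau> x2 = const 1 * x2 + const 0"
      by (simp_all add: e alg_homD[OF carrier_Aut2_hom[OF swap_carrier]] Aut2_poly_at[OF swap_carrier])
    then have "?\<tau> \<in> triangular UNIV" by (rule triangularI[OF car a0 one_neq_zero supp])
    moreover have "?\<tau> \<in> extend_auts (carrier Aut2)"
      using subgroup.m_closed[OF integral_subgroup] \<phi>_int swap_integral by blast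
    ultimately have "?\<tau> \<in> W" using assms(3) by blast
    then have "swap \<otimes>\<^bsub>Aut2\<^esub> ?\<tau> \<otimes>\<^bsub>Aut2\<^esub> swap \<in> W"
      using subgroup.m_closed[OF assms(1)] assms(2) by blast
    moreover have "swap \<otimes>\<^bsub>Aut2\<^esub> ?\<tau> \<otimes>\<^bsub>Aut2\<^esub> swap = \<phi>"
    proof
      fix f
      have sw: "swap (swap g) = g" for g :: "'a fract poly poly" using fun_cong[OF swap_swap, of g] by simp
      show "(swap \<otimes>\<^bsub>Aut2\<^esub> ?\<tau> \<otimes>\<^bsub>Aut2\<^esub> swap) f = \<phi> f" by (simp add: sw)
    qed
    ultimately show ?thesis by (simp only:)
  qed
qed

lemma extend_tame:
  assumes W: "subgroup W Aut2"
    and aff: "affine_auts \<inter> extend_auts (carrier Aut2) \<subseteq> W"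
    and tri: "triangular UNIV \<inter> extend_auts (carrier Aut2) \<subseteq> W"
  shows "extend_auts tame \<subseteq> W"
  unfolding tame_def
proof (rule extend_auts_generate[OF _ W])
  show "affine_auts \<union> elementary_auts \<subseteq> carrier Aut2"
    using affine_carrier elementary_carrier by blast
  have "swap \<in> W" using aff swap_affine swap_integral by blast
  then have "extend_auts elementary_auts \<subseteq> W" using extend_elementary[OF W] tri by blast
  moreover have "extend_auts affine_auts \<subseteq> extend_auts (carrier Aut2)"
    by (intro extend_auts_mono affine_carrier)
  then have "extend_auts affine_auts \<subseteq> W" using aff extend_affine by blast
  ultimately show "extend_auts (affine_auts \<union> elementary_auts) \<subseteq> W"
    unfolding extend_auts_def by blast
qed


section \<open>Shears, transvections and the groups of affine type\<close>

definition shear :: "'a::comm_ring_1 poly \<Rightarrow> 'a poly poly \<Rightarrow> 'a poly poly" where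
  "shear Q = subst (x1 + poly_at Q x2) x2"

definition transvection :: "'a::comm_ring_1 \<Rightarrow> 'a poly poly \<Rightarrow> 'a poly poly" where
  "transvection c = subst x1 (x2 + const c * x1)"

lemma shear_vars [simp]: "shear Q x1 = x1 + poly_at Q x2" "shear Q x2 = x2"
  by (simp_all add: shear_def)

lemma transvection_vars [simp]: "transvection c x1 = x1" "transvection c x2 = x2 + const c * x1"
  by (simp_all add: transvection_def)

lemma shear_hom: "alg_hom id (shear Q)"
  unfolding shear_def by (rule alg_hom_subst)

lemma transvection_hom: "alg_hom id (transvection c)"
  unfolding transvection_def by (rule alg_hom_subst)

lemma shear_mult: "shear P \<circ> shear Q = shear (P + Q)"
proof
  fix f
  have "alg_hom id (shear P \<circ> shear Q)" using alg_hom_comp[OF shear_hom shear_hom] by simp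
  then show "(shear P \<circ> shear Q) f = shear (P + Q) f"
    by (rule alg_hom_eqI[OF _ shear_hom])
      (simp_all add: alg_homD[OF shear_hom] alg_hom_poly_at[OF shear_hom] algebra_simps)
qed

lemma transvection_mult: "transvection b \<circ> transvection c = transvection (b + c)"
proof
  fix f
  have "alg_hom id (transvection b \<circ> transvection c)"
    using alg_hom_comp[OF transvection_hom transvection_hom] by simp
  then show "(transvection b \<circ> transvection c) f = transvection (b + c) f"
    by (rule alg_hom_eqI[OF _ transvection_hom])
      (simp_all add: alg_homD[OF transvection_hom] algebra_simps)
qed

lemma shear_0: "shear 0 = id"
proof
  show "shear 0 f = id f" for f by (rule alg_hom_eqI[OF shear_hom alg_hom_id]) simp_all
qed

lemma transvection_0: "transvection 0 = id"
proof
  show "transvection 0 f = id f" for f by (rule alg_hom_eqI[OF transvection_hom alg_hom_id]) simp_all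
qed

lemma shear_carrier: "shear Q \<in> carrier Aut2"
  using o_bij[of "shear (- Q)" "shear Q"] by (simp add: carrier_Aut2_iff shear_hom shear_mult shear_0)

lemma transvection_carrier: "transvection c \<in> carrier Aut2"
  using o_bij[of "transvection (- c)" "transvection c"]
  by (simp add: carrier_Aut2_iff transvection_hom transvection_mult transvection_0)

lemma shear_B_set: "(\<forall>i. coeff Q i \<noteq> 0 \<longrightarrow> i \<in> I) \<Longrightarrow> shear Q \<in> B_set I"
  unfolding B_set_def mem_Collect_eq
  by (intro conjI exI[of _ Q]) (simp_all add: shear_carrier in_x_poly_at)

lemma transvection_affine: "transvection c \<in> affine_auts"
  by (rule affine_autsI[of "transvection c" 1 1 c 0 0 0]) (simp_all add: transvection_carrier add.commute)

lemma transvection_not_triangular: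
  assumes "c \<noteq> 0"
  shows "transvection c \<notin> triangular I"
proof
  assume "transvection c \<in> triangular I"
  then obtain c' d where "x2 + const c * x1 = const c' * x2 + const d"
    by (rule triangularE) (simp only: transvection_vars)
  then have "coeff (coeff (x2 + const c * x1) 0) 1 = coeff (coeff (const c' * x2 + const d) 0) 1"
    by (simp only:)
  then show False using assms by (simp add: const_def x1_def x2_def)
qed

lemma swap_not_triangular: "(swap :: 'a::field poly poly \<Rightarrow> _) \<notin> triangular I"
proof
  assume "(swap :: 'a poly poly \<Rightarrow> _) \<in> triangular I"
  then obtain c' d where "swap x2 = const c' * x2 + (const d :: 'a poly poly)"
    by (rule triangularE) blast
  then have "x1 = const c' * x2 + (const d :: 'a poly poly)" by simp
  then have "coeff (coeff (x1 :: 'a poly poly) 0) 1 = coeff (coeff (const c' * x2 + const d) 0) 1"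
    by (simp only:)
  then show False by (simp add: const_def x1_def x2_def)
qed

lemma shear_triangular_iff: "shear Q \<in> triangular I \<longleftrightarrow> affinely_supported I Q"
proof
  assume "shear Q \<in> triangular I"
  then obtain a P where P: "affinely_supported I P" and e: "x1 + poly_at Q x2 = const a * x1 + poly_at P x2"
    by (rule triangularE) (simp only: shear_vars)
  then have "const 1 * x1 + poly_at Q x2 = const a * x1 + poly_at P x2" by simp
  then have "coeff Q k = coeff P k" for k by (metis coeff_triangular_image(1))
  then show "affinely_supported I Q" using P by (simp add: affinely_supported_def)
next
  assume "affinely_supported I Q"
  then show "shear Q \<in> triangular I"
    by (intro triangularI[of "shear Q" 1 1 I Q 0]) (simp_all add: shear_carrier)
qed

lemma CHAR_fract: "CHAR('a::idom fract) = CHAR('a)"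
proof (rule CHAR_eqI)
  have of_nat: "(of_nat n :: 'a fract) = to_fract (of_nat n)" for n
    by (induction n) simp_all
  show "of_nat CHAR('a) = (0 :: 'a fract)" by (simp add: of_nat)
  show "CHAR('a) dvd n" if "of_nat n = (0 :: 'a fract)" for n
    using that by (simp add: of_nat of_nat_eq_0_iff_char_dvd)
qed

lemma B_set_subset_triangular: "B_set I \<subseteq> triangular I"
proof
  fix \<phi> :: "'a poly poly \<Rightarrow> 'a poly poly" assume "\<phi> \<in> B_set I"
  then obtain P where P: "\<phi> \<in> carrier Aut2" "\<forall>i. coeff P i \<noteq> 0 \<longrightarrow> i \<in> I" "\<phi> x1 = x1 + in_x2 P" "\<phi> x2 = x2"
    unfolding B_set_def by blast
  then show "\<phi> \<in> triangular I"
    by (intro triangularI[of \<phi> 1 1 I P 0]) (simp_all add: affinely_supported_def in_x_poly_at)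
qed

lemma B_set_carrier: "B_set I \<subseteq> carrier Aut2"
  unfolding B_set_def by blast

lemma A_grp_subgroup: "subgroup (A_grp I) Aut2"
  unfolding A_grp_def using affine_carrier B_set_carrier by (intro Aut2.generate_is_subgroup Un_least)

lemma A_grp_subset_generate: "A_grp I \<subseteq> generate Aut2 (affine_auts \<union> triangular I)"
  unfolding A_grp_def using B_set_subset_triangular by (intro Aut2.mono_generate) blast

text \<open>
  Removing the terms of degree at least two with a shear leaves an affine automorphism.
\<close>
lemma triangular_subset_A_grp: "triangular I \<subseteq> A_grp I"
proof
  fix \<phi> :: "'a poly poly \<Rightarrow> 'a poly poly" assume "\<phi> \<in> triangular I"
  then obtain a P c d where \<phi>: "\<phi> \<in> carrier Aut2" "a \<noteq> 0" "c \<noteq> 0" "affinely_supported I P"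
    "\<phi> x1 = const a * x1 + poly_at P x2" "\<phi> x2 = const c * x2 + const d"
    by (rule triangularE)
  let ?L = "[:coeff P 0, coeff P 1:]"
  define Q where "Q = smult (1 / a) (P - ?L)"
  have aQ: "smult a Q = P - ?L" using \<phi>(2) by (simp add: Q_def)
  have "i \<in> I" if "coeff Q i \<noteq> 0" for i
  proof -
    have "coeff (P - ?L) i \<noteq> 0" using that by (auto simp: Q_def)
    then have "coeff P i \<noteq> 0" "\<not> i \<le> 1"
      by (auto simp: coeff_pCons le_Suc_eq split: nat.splits if_splits)
    then show ?thesis using \<phi>(4) unfolding affinely_supported_def by blast
  qed
  then have Q: "shear Q \<in> A_grp I" unfolding A_grp_def by (intro generate.incl UnI2 shear_B_set) blast
  let ?\<alpha> = "shear (- Q) \<otimes>\<^bsub>Aut2\<^esub> \<phi>"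
  have car: "?\<alpha> \<in> carrier Aut2" using shear_carrier \<phi>(1) by (rule Aut2.m_closed)
  note hom = alg_homD[OF shear_hom] Aut2_poly_at[OF shear_carrier]
  have "?\<alpha> x1 = const a * x1 - poly_at (smult a Q) x2 + poly_at P x2"
    by (simp add: \<phi>(5) hom algebra_simps)
  also have "\<dots> = const a * x1 + const (coeff P 1) * x2 + const (coeff P 0)"
    unfolding aQ by (simp add: algebra_simps)
  finally have x: "?\<alpha> x1 = const a * x1 + const (coeff P 1) * x2 + const (coeff P 0)" .
  have y: "?\<alpha> x2 = const 0 * x1 + const c * x2 + const d"
    by (simp add: \<phi>(6) hom)
  have "?\<alpha> \<in> affine_auts"
    by (rule affine_autsI[OF car _ x y]) (simp add: dvd_field_iff \<phi>(2,3))
  then have "?\<alpha> \<in> A_grp I" unfolding A_grp_def by (intro generate.incl UnI1)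
  then have "shear Q \<otimes>\<^bsub>Aut2\<^esub> ?\<alpha> \<in> A_grp I" using Q subgroup.m_closed[OF A_grp_subgroup] by blast
  moreover have "shear Q \<otimes>\<^bsub>Aut2\<^esub> ?\<alpha> = \<phi>"
    by (simp add: shear_mult shear_0 flip: comp_assoc)
  ultimately show "\<phi> \<in> A_grp I" by (simp only:)
qed


section \<open>A conjugate that leaves the subgroup\<close>

text \<open>
  With \<open>c = e z\<^sup>2\<close>, \<open>N\<close> sends \<open>y\<close> to \<open>G = y + z (e z x + e y\<^sup>n)\<close> and \<open>x\<close> to \<open>x - (G\<^sup>n - y\<^sup>n) / z\<close>.
  The numerator is divisible by \<open>G - y\<close>, hence by \<open>z\<close>. The square of \<open>z\<close> is needed because \<open>G - y\<close>
  already loses one factor \<open>z\<close> to the denominator of the shear. The parameter \<open>e\<close> takes the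
  values \<open>1\<close> and \<open>-1\<close>, for the automorphism and its inverse.
\<close>
lemma conj_transvection_images:
  fixes z e :: "'a::idom" and n :: nat
  assumes z: "z \<noteq> 0"
  defines "Q \<equiv> monom (1 / to_fract z) n"
  defines "N \<equiv> shear Q \<circ> transvection (to_fract (e * z ^ 2)) \<circ> shear (- Q)"
  shows "N x1 \<in> range embed" "N x2 \<in> range embed"
proof -
  note hom = alg_homD[OF shear_hom] alg_homD[OF transvection_hom]
    alg_hom_poly_at[OF shear_hom] alg_hom_poly_at[OF transvection_hom]
  define G where "G = (x2 :: 'a poly poly) + const z * (const (e * z) * x1 + const e * x2 ^ n)"
  have inv: "const (to_fract z) * const (1 / to_fract z) = 1"
    using z by (simp flip: const_hom(4))
  have ce: "to_fract (e * z ^ 2) = to_fract (e * z) * to_fract z"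
    by (simp add: power2_eq_square)
  have Nx2: "N x2 = x2 + const (to_fract (e * z)) * (const (to_fract z) * x1
      + const (to_fract z) * const (1 / to_fract z) * x2 ^ n)"
    unfolding N_def Q_def ce by (simp add: hom algebra_simps)
  have G: "N x2 = embed G"
    unfolding Nx2 inv G_def by (simp add: embed_simps algebra_simps)
  then show "N x2 \<in> range embed" by blast
  have "G - x2 dvd G ^ n - x2 ^ n" by (simp add: power_diff_sumr2)
  moreover have "const z dvd G - x2" by (simp add: G_def)
  ultimately obtain T where T: "G ^ n - x2 ^ n = const z * T" by (meson dvd_def dvd_trans)
  have "N x1 = x1 + const (1 / to_fract z) * x2 ^ n - const (1 / to_fract z) * (N x2) ^ n"
    unfolding N_def Q_def by (simp add: hom)
  also have "\<dots> = x1 - const (1 / to_fract z) * embed (G ^ n - x2 ^ n)"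
    unfolding G by (simp add: embed_simps algebra_simps)
  also have "\<dots> = x1 - (const (to_fract z) * const (1 / to_fract z)) * embed T"
    unfolding T embed_simps by (simp only: mult_ac)
  also have "\<dots> = embed (x1 - T)" unfolding inv by (simp add: embed_simps)
  finally show "N x1 \<in> range embed" by blast
qed

lemma conj_transvection_inv:
  "inv\<^bsub>Aut2\<^esub> (shear Q \<circ> transvection c \<circ> shear (- Q)) = shear Q \<circ> transvection (- c) \<circ> shear (- Q)"
proof (rule Aut2.inv_equality)
  have s: "shear P (shear P' f) = shear (P + P') f" for P P' :: "'a poly" and f
    using fun_cong[OF shear_mult] by simp
  have t: "transvection b (transvection b' f) = transvection (b + b') f" for b b' :: 'a and f
    using fun_cong[OF transvection_mult] by simp
  show "(shear Q \<circ> transvection (- c) \<circ> shear (- Q)) \<otimes>\<^bsub>Aut2\<^esub> (shear Q \<circ> transvection c \<circ> shear (- Q)) = \<one>\<^bsub>Aut2\<^esub>"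
    by (simp add: fun_eq_iff s t shear_0 transvection_0)
qed (use Aut2.m_closed[OF Aut2.m_closed[OF shear_carrier transvection_carrier] shear_carrier] in simp_all)

lemma conj_transvection_integral:
  fixes z :: "'a::idom" and n :: nat
  assumes z: "z \<noteq> 0"
  defines "Q \<equiv> monom (1 / to_fract z) n"
  shows "shear Q \<circ> transvection (to_fract (z ^ 2)) \<circ> shear (- Q) \<in> extend_auts (carrier Aut2)"
proof (rule integralI)
  show "shear Q \<circ> transvection (to_fract (z ^ 2)) \<circ> shear (- Q) \<in> carrier Aut2"
    using Aut2.m_closed[OF Aut2.m_closed[OF shear_carrier transvection_carrier] shear_carrier] by simp
qed (use conj_transvection_images[OF z, of n 1] conj_transvection_images[OF z, of n "-1"] in
    \<open>simp_all add: conj_transvection_inv flip: Q_def\<close>)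

text \<open>
  The coefficient of \<open>y\<^sup>n\<close> in the image of \<open>x\<close> is \<open>P\<^sub>n - a / z\<close>, where \<open>a\<close> and \<open>P\<^sub>n\<close> come from \<open>v\<close>. It would
  have to vanish, but \<open>P\<^sub>n\<close> is in \<open>R\<close> and \<open>a\<close> is a unit of \<open>R\<close>, so \<open>1/z\<close> would be in \<open>R\<close>.
\<close>
lemma shear_notin_coset:
  fixes z :: "'a::idom" and n :: nat
  assumes z: "z \<noteq> 0" "\<not> z dvd 1" and n: "2 \<le> n" "n \<notin> I"
    and v: "v \<in> triangular UNIV \<inter> extend_auts (carrier Aut2)"
  shows "shear (- monom (1 / to_fract z) n) \<circ> v \<notin> triangular I"
proof
  let ?Q = "- monom (1 / to_fract z) n"
  assume "shear ?Q \<circ> v \<in> triangular I"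
  then obtain a' P' where P': "affinely_supported I P'"
    and eq: "(shear ?Q \<circ> v) x1 = const a' * x1 + poly_at P' x2"
    by (rule triangularE) blast
  have "v \<in> triangular UNIV" using v by blast
  then obtain a P c d where 1: "v \<in> carrier Aut2" "v x1 = const a * x1 + poly_at P x2" "v x2 = const c * x2 + const d"
    by (rule triangularE)
  have "(shear ?Q \<circ> v) x1 = const a * x1 + poly_at (smult a ?Q + P) x2"
    by (simp add: 1(2) alg_homD[OF shear_hom] alg_hom_poly_at[OF shear_hom] algebra_simps)
  then have "const a' * x1 + poly_at P' x2 = const a * x1 + poly_at (smult a ?Q + P) x2"
    using eq by (simp only:)
  then have "coeff P' n = coeff (smult a ?Q + P) n"
    by (metis coeff_triangular_image(1))
  moreover have "coeff P' n = 0" using P' n unfolding affinely_supported_def by force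
  ultimately have "a / to_fract z = coeff P n" by simp
  moreover obtain r where "coeff P n = to_fract r"
    using triangular_integral_coeffs(2)[OF v 1(2)] by blast
  moreover obtain s where s: "a * to_fract s = 1"
    using triangular_integral_unit[OF v 1(2)] by blast
  ultimately have "a = to_fract r * to_fract z" using z(1) by (simp add: field_simps)
  then have "to_fract (z * (r * s)) = to_fract 1" using s by (simp add: mult_ac)
  then have "1 = z * (r * s)" by (simp only: to_fract_eq_iff)
  then show False using z(2) by (metis dvd_triv_left)
qed

lemma T_grp_subset_generate:
  "T_grp (A_grp I) \<subseteq> generate Aut2 ((A_grp I \<inter> extend_auts (carrier Aut2)) \<union>
     (triangular UNIV \<inter> extend_auts (carrier Aut2)))" (is "_ \<subseteq> generate Aut2 (?U \<union> ?V)")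
proof -
  have UV: "?U \<union> ?V \<subseteq> carrier Aut2" unfolding extend_auts_def by blast
  have W: "subgroup (generate Aut2 (?U \<union> ?V)) Aut2" using UV by (rule Aut2.generate_is_subgroup)
  have U: "?U \<subseteq> generate Aut2 (?U \<union> ?V)" and V: "?V \<subseteq> generate Aut2 (?U \<union> ?V)"
    by (auto intro: generate.incl)
  have "affine_auts \<subseteq> A_grp I" unfolding A_grp_def by (auto intro: generate.incl)
  then have "extend_auts tame \<subseteq> generate Aut2 (?U \<union> ?V)"
    using U V by (intro extend_tame[OF W]) blast+
  then show ?thesis
    unfolding T_grp_def using U by (intro Aut2.generate_subgroup_incl[OF _ W] Un_least)
qed

text \<open>
  If the conjugate \<open>w\<close> were in the subgroup, so would be its inverse. Writing \<open>w = f \<beta>\<close> with \<open>\<beta>\<close> the last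
  letter, the product \<open>f \<beta> w\<^sup>-\<^sup>1\<close> is the identity, whereas \<open>amalgam_words_stay_out\<close> makes the degree of its
  image of \<open>y\<close> at least two.
\<close>
lemma not_normal_witness:
  fixes z :: "'a::idom" and n :: nat
  assumes z: "z \<noteq> 0" "\<not> z dvd 1" and n: "2 \<le> n" "n \<notin> I" and I: "p_stable CHAR('a) I"
  defines "Q \<equiv> monom (1 / to_fract z) n"
  defines "N \<equiv> shear Q \<circ> transvection (to_fract (z ^ 2)) \<circ> shear (- Q)"
  shows "N \<otimes>\<^bsub>Aut2\<^esub> swap \<otimes>\<^bsub>Aut2\<^esub> inv\<^bsub>Aut2\<^esub> N \<notin> T_grp (A_grp I)"
proof
  let ?w = "N \<otimes>\<^bsub>Aut2\<^esub> swap \<otimes>\<^bsub>Aut2\<^esub> inv\<^bsub>Aut2\<^esub> N"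
  let ?U = "A_grp I \<inter> extend_auts (carrier Aut2)"
  let ?V = "triangular UNIV \<inter> extend_auts (carrier (Aut2 :: ('a poly poly \<Rightarrow> _) monoid))"
  let ?c = "to_fract (z ^ 2)"
  assume "?w \<in> T_grp (A_grp I)"
  then have w: "inv\<^bsub>Aut2\<^esub> ?w \<in> generate Aut2 (?U \<union> ?V)" and wcar: "?w \<in> carrier Aut2"
    using subgroup.m_inv_closed[OF T_grp_subgroup] subgroup.mem_carrier[OF T_grp_subgroup]
      T_grp_subset_generate by blast+
  have c: "?c \<noteq> 0" "- ?c \<noteq> 0" using z(1) by simp_all
  have tri_UNIV: "subgroup (triangular UNIV) (Aut2 :: ('a fract poly poly \<Rightarrow> _) monoid)"
    by (rule triangular_subgroup) (simp add: p_stable_def)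
  \<comment> \<open>Taking the empty set of exponents in \<open>affine_Int_triangular\<close> shows that an affine shear has
    degree at most one.\<close>
  have "\<not> affinely_supported {} Q" "\<not> affinely_supported {} (- Q)"
    using n(1) z(1) by (auto simp: affinely_supported_def Q_def intro!: exI[of _ n])
  then have b: "shear Q \<in> triangular UNIV - affine_auts" "shear (- Q) \<in> triangular UNIV - affine_auts"
    using affine_Int_triangular[of UNIV "{}"] shear_triangular_iff
    by (force simp: affinely_supported_def)+
  have t: "transvection ?c \<in> affine_auts - triangular UNIV" "transvection (- ?c) \<in> affine_auts - triangular UNIV"
    using transvection_affine transvection_not_triangular c by blast+
  have s: "swap \<in> affine_auts - triangular (UNIV :: nat set)"
    using swap_affine swap_not_triangular by blast
  have up: "\<phi> \<otimes>\<^bsub>Aut2\<^esub> \<beta> \<in> steep" if "\<phi> \<in> flat" "\<beta> \<in> triangular UNIV - affine_auts"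
    for \<phi> \<beta> :: "'a fract poly poly \<Rightarrow> _"
    using that flat_mult_triangular[of \<phi> \<beta>] by (simp add: flat_def)
  have down: "\<phi> \<otimes>\<^bsub>Aut2\<^esub> \<alpha> \<in> flat" if "\<phi> \<in> steep" "\<alpha> \<in> affine_auts - triangular UNIV"
    for \<phi> \<alpha> :: "'a fract poly poly \<Rightarrow> _"
    using that steep_mult_affine[of \<phi> \<alpha>] by simp
  define f where "f = shear Q \<otimes>\<^bsub>Aut2\<^esub> transvection ?c \<otimes>\<^bsub>Aut2\<^esub> shear (- Q) \<otimes>\<^bsub>Aut2\<^esub> swap
      \<otimes>\<^bsub>Aut2\<^esub> shear Q \<otimes>\<^bsub>Aut2\<^esub> transvection (- ?c)"
  have "id \<circ> shear Q \<in> steep"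
    using id_carrier b(1) by (intro flat_mult_triangular) (simp_all add: x1_def x2_def)
  then have "shear Q \<in> steep" by simp
  then have f: "f \<in> flat" unfolding f_def by (intro down up b t s)
  have "f \<otimes>\<^bsub>Aut2\<^esub> shear (- Q) = ?w"
    unfolding N_def f_def conj_transvection_inv by (simp add: comp_assoc)
  then have id: "f \<otimes>\<^bsub>Aut2\<^esub> shear (- Q) \<otimes>\<^bsub>Aut2\<^esub> inv\<^bsub>Aut2\<^esub> ?w = \<one>\<^bsub>Aut2\<^esub>"
    using Aut2.r_inv[OF wcar] by (simp only:)
  have "\<exists>g\<in>flat. \<exists>b'\<in>triangular UNIV. f \<otimes>\<^bsub>Aut2\<^esub> shear (- Q) \<otimes>\<^bsub>Aut2\<^esub> inv\<^bsub>Aut2\<^esub> ?w = g \<otimes>\<^bsub>Aut2\<^esub> b'"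
  proof (rule Aut2.amalgam_words_stay_out[where A = affine_auts and B = "triangular UNIV"
        and C = "triangular I" and SA = flat and SB = steep and U = ?U and V = ?V])
    show "subgroup ?U Aut2"
      using A_grp_subgroup integral_subgroup by (rule Aut2.subgroups_Inter_pair)
    show "subgroup ?V Aut2"
      using tri_UNIV integral_subgroup by (rule Aut2.subgroups_Inter_pair)
    show "shear (- Q) \<otimes>\<^bsub>Aut2\<^esub> v \<notin> triangular I" if "v \<in> ?V" for v
      using shear_notin_coset[OF z n that] by (simp add: Q_def)
    show "subgroup (triangular I) (Aut2 :: ('a fract poly poly \<Rightarrow> _) monoid)"
      using I by (intro triangular_subgroup) (simp add: CHAR_fract)
    show "?U \<subseteq> generate Aut2 (affine_auts \<union> triangular I)" using A_grp_subset_generate by blast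
    show "?V \<inter> triangular I \<subseteq> ?U" using triangular_subset_A_grp by blast
    show "shear (- Q) \<in> triangular UNIV" using b by blast
    show "triangular I \<subseteq> triangular UNIV" by (rule triangular_mono) simp
    show "affine_auts \<inter> triangular UNIV \<subseteq> triangular I" by (rule affine_Int_triangular)
    show "flat \<subseteq> carrier Aut2" unfolding flat_def by blast
  qed (use affine_subgroup tri_UNIV f w up down in \<open>blast+\<close>)
  then obtain g b' :: "'a fract poly poly \<Rightarrow> 'a fract poly poly"
    where gb: "g \<in> flat" "b' \<in> triangular UNIV" and "\<one>\<^bsub>Aut2\<^esub> = g \<otimes>\<^bsub>Aut2\<^esub> b'"
    unfolding id by blast
  then have "id = g \<circ> b'" by (simp only: one_Aut2 mult_Aut2)
  note g = gb this
  obtain c d where b': "c \<noteq> 0" "b' x2 = const c * x2 + const d"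
    using g(2) by (rule triangularE) blast
  have "x2 = const c * g x2 + const d"
    using fun_cong[OF g(3), of x2] g(1) by (simp add: b' flat_def alg_homD[OF carrier_Aut2_hom])
  then have "degree (x2 :: 'a fract poly poly) = degree (const c * g x2 + const d)" by (simp only:)
  also have "\<dots> = degree (g x2)"
    using g(1) b'(1) degree_add_eq_left[of "const d" "const c * g x2"]
    by (simp add: flat_def degree_const_mult)
  finally show False using g(1) by (simp add: flat_def x2_def)
qed

theorem theorem1p4:
  fixes p :: nat
    and H1 H2 :: "('r::idom fract poly poly \<Rightarrow> 'r fract poly poly) set"
  assumes "CHAR('r) = p"
    and "\<not> (\<forall>a::'r. a \<noteq> 0 \<longrightarrow> a dvd 1)"
    and "affine_type_subgroup p H1"
    and "affine_type_subgroup p H2"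
    and "H1 \<subset> H2"
  shows "subgroup (T_grp H1) (Aut2\<lparr>carrier := T_grp H2\<rparr>) \<and>
         \<not> T_grp H1 \<lhd> Aut2\<lparr>carrier := T_grp H2\<rparr>"
proof
  obtain I1 I2 where I1: "p_stable p I1" "H1 = A_grp I1" and I2: "I2 \<subseteq> {2..}" "H2 = A_grp I2"
    using assms(3,4) unfolding affine_type_subgroup_def by blast
  have sub: "T_grp H1 \<subseteq> T_grp H2"
    unfolding T_grp_def using assms(5) by (intro Aut2.mono_generate) blast
  show "subgroup (T_grp H1) (Aut2\<lparr>carrier := T_grp H2\<rparr>)"
    by (rule Aut2.subgroup_incl[OF T_grp_subgroup T_grp_subgroup sub])
  have "\<not> I2 \<subseteq> I1"
  proof
    assume "I2 \<subseteq> I1"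
    then have "B_set I2 \<subseteq> (B_set I1 :: ('r fract poly poly \<Rightarrow> _) set)" unfolding B_set_def by blast
    then have "H2 \<subseteq> H1" unfolding I1(2) I2(2) A_grp_def by (intro Aut2.mono_generate) blast
    then show False using assms(5) by blast
  qed
  then obtain n where n: "n \<in> I2" "2 \<le> n" "n \<notin> I1" using I2(1) by auto
  obtain z :: 'r where z: "z \<noteq> 0" "\<not> z dvd 1" using assms(2) by blast
  let ?Q = "monom (1 / to_fract z) n"
  let ?N = "shear ?Q \<circ> transvection (to_fract (z ^ 2)) \<circ> shear (- ?Q)"
  have "shear ?Q \<in> B_set I2" "shear (- ?Q) \<in> B_set I2"
    using n(1) by (auto intro!: shear_B_set split: if_splits)
  then have "shear ?Q \<otimes>\<^bsub>Aut2\<^esub> transvection (to_fract (z ^ 2)) \<otimes>\<^bsub>Aut2\<^esub> shear (- ?Q) \<in> H2"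
    unfolding I2(2) A_grp_def using transvection_affine by (intro generate.eng generate.incl UnI1 UnI2)
  then have "?N \<in> H2 \<inter> extend_auts (carrier Aut2)"
    using conj_transvection_integral[OF z(1)] by simp
  then have N: "?N \<in> T_grp H2" unfolding T_grp_def by (intro generate.incl UnI1)
  have "swap \<in> A_grp I1" unfolding A_grp_def by (intro generate.incl UnI1 swap_affine)
  then have s: "swap \<in> T_grp H1"
    unfolding T_grp_def I1(2) using swap_integral by (intro generate.incl UnI1 IntI)
  show "\<not> T_grp H1 \<lhd> Aut2\<lparr>carrier := T_grp H2\<rparr>"
  proof
    assume "T_grp H1 \<lhd> Aut2\<lparr>carrier := T_grp H2\<rparr>"
    then have "?N \<otimes>\<^bsub>Aut2\<^esub> swap \<otimes>\<^bsub>Aut2\<^esub> inv\<^bsub>Aut2\<lparr>carrier := T_grp H2\<rparr>\<^esub> ?N \<in> T_grp H1"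
      using normal.inv_op_closed2[of "T_grp H1" "Aut2\<lparr>carrier := T_grp H2\<rparr>" ?N swap] N s by simp
    then have "?N \<otimes>\<^bsub>Aut2\<^esub> swap \<otimes>\<^bsub>Aut2\<^esub> inv\<^bsub>Aut2\<^esub> ?N \<in> T_grp H1"
      using Aut2.m_inv_consistent[OF T_grp_subgroup N] by (simp only:)
    then show False
      using not_normal_witness[OF z n(2,3)] I1 assms(1) by blast
  qed
qed

end
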